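(* Let $d$ and $k$ be positive integers, and put $$n(d,k)=k+\binom{d+k-1}{d}.$$ Then for every $n\ge n(d,k)$ every (continuous) section of the bundle $\Sigma^d(\mathbb C\gamma_n^k)$ over $\mathbb CG_n^k$ has a zero.
   Context: $\mathbb CG_n^k$ is the Grassmannian of $k$-dimensional complex linear subspaces of $\mathbb C^n$, and $\mathbb C\gamma_n^k$ is its canonical (tautological) complex vector bundle, whose fiber over $V$ is $V$. For a complex vector bundle $\xi$, $\Sigma^d(\xi)$ denotes its fiberwise (complex) symmetric $d$-th power. All sections are continuous (not assumed holomorphic). *)

theory Defs
  imports "HOL-Analysis.Analysis"
begin

section \<open>Subbundles of trivial bundles\<close>

text \<open>
  Every bundle below is a subbundle of a trivial complex bundle over a space \<open>X\<close>. It is given by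
  the family \<open>E\<close> of its fibres, and its total space has the topology induced from the product.
\<close>

definition total_space :: "'b topology \<Rightarrow> ('b \<Rightarrow> (complex ^ 'm) set) \<Rightarrow> ('b \<times> (complex ^ 'm)) topology"
  where "total_space X E = subtopology (prod_topology X euclidean) (Sigma (topspace X) E)"

definition bundle_section ::
    "'b topology \<Rightarrow> ('b \<Rightarrow> (complex ^ 'm) set) \<Rightarrow> ('b \<Rightarrow> 'b \<times> (complex ^ 'm)) \<Rightarrow> bool"
  where "bundle_section X E s \<longleftrightarrow>
    continuous_map X (total_space X E) s \<and> (\<forall>b \<in> topspace X. fst (s b) = b)"

section \<open>Complex Grassmannians\<close>

text \<open>
  The constants qualified by \<open>vec\<close> refer to scalar multiplication by elements of the ground field,
  hence are complex-linear on \<open>complex ^ 'n\<close>; the unqualified \<open>span\<close>, \<open>dim\<close>, \<open>subspace\<close> are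
  real-linear.
\<close>

definition grassmannian_set :: "nat \<Rightarrow> (complex ^ 'n) set set"
  where "grassmannian_set k = {V. vec.subspace V \<and> vec.dim V = k}"

definition frames :: "nat \<Rightarrow> (nat \<Rightarrow> complex ^ 'n) topology"
  where "frames k = subtopology (product_topology (\<lambda>_. euclidean) {..<k})
    {v. inj_on v {..<k} \<and> vec.independent (v ` {..<k})}"

definition frame_span :: "nat \<Rightarrow> (nat \<Rightarrow> complex ^ 'n) \<Rightarrow> (complex ^ 'n) set"
  where "frame_span k v = vec.span (v ` {..<k})"

text \<open>The Grassmannian carries the quotient topology from the space of linearly independent
  \<open>k\<close>-tuples.\<close>

definition grassmannian :: "nat \<Rightarrow> (complex ^ 'n) set topology"
  where "grassmannian k = topology (\<lambda>U. U \<subseteq> grassmannian_set k \<and>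
    openin (frames k) {v \<in> topspace (frames k). frame_span k v \<in> U})"

lemma openin_grassmannian:
  fixes U :: "(complex ^ 'n) set set"
  shows "openin (grassmannian k) U \<longleftrightarrow> U \<subseteq> grassmannian_set k \<and>
    openin (frames k) {v \<in> topspace (frames k). frame_span k v \<in> U}"
proof -
  have "istopology (\<lambda>U :: (complex ^ 'n) set set. U \<subseteq> grassmannian_set k \<and>
    openin (frames k) {v \<in> topspace (frames k). frame_span k v \<in> U})" (is "istopology ?P")
    unfolding istopology_def
  proof (intro conjI allI impI)
    fix S T assume "?P S" "?P T"
    moreover have "{v \<in> topspace (frames k). frame_span k v \<in> S \<inter> T} =
      {v \<in> topspace (frames k). frame_span k v \<in> S} \<inter> {v \<in> topspace (frames k). frame_span k v \<in> T}"
      by auto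
    ultimately show "S \<inter> T \<subseteq> grassmannian_set k"
      and "openin (frames k) {v \<in> topspace (frames k). frame_span k v \<in> S \<inter> T}"
      by auto
  next
    fix \<K> assume K: "\<forall>K\<in>\<K>. ?P K"
    then show "\<Union>\<K> \<subseteq> grassmannian_set k" by auto
    have "{v \<in> topspace (frames k). frame_span k v \<in> \<Union>\<K>} =
      (\<Union>K\<in>\<K>. {v \<in> topspace (frames k). frame_span k v \<in> K})" by auto
    with K show "openin (frames k) {v \<in> topspace (frames k). frame_span k v \<in> \<Union>\<K>}"
      by auto
  qed
  then show ?thesis by (simp add: grassmannian_def topology_inverse')
qed

lemma frame_span_image: "frame_span k ` topspace (frames k) = grassmannian_set k"
proof (intro equalityI subsetI)
  fix V assume "V \<in> frame_span k ` topspace (frames k)"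
  then obtain v where v: "inj_on v {..<k}" "vec.independent (v ` {..<k})"
    and V: "V = vec.span (v ` {..<k})"
    by (auto simp: frames_def frame_span_def)
  from v have "vec.dim V = k"
    by (simp add: V vec.dim_eq_card_independent card_image)
  then show "V \<in> grassmannian_set k"
    by (simp add: grassmannian_set_def V vec.subspace_span)
next
  fix V :: "(complex ^ 'n) set" assume "V \<in> grassmannian_set k"
  then have V: "vec.subspace V" "vec.dim V = k"
    by (auto simp: grassmannian_set_def)
  obtain B where B: "B \<subseteq> V" "vec.independent B" "V \<subseteq> vec.span B" "card B = k"
    using vec.basis_exists[of V] V(2) by metis
  have fin: "finite B" using B(2) by (rule vec.finiteI_independent)
  from ex_bij_betw_nat_finite[OF fin] B(4) obtain g where "bij_betw g {0..<k} B"
    by auto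
  then have g: "bij_betw g {..<k} B" by (simp add: atLeast0LessThan)
  define v where "v = restrict g {..<k}"
  have v: "inj_on v {..<k}" "v ` {..<k} = B"
    using g by (auto simp: v_def bij_betw_def)
  have "vec.span B = V"
    using B V(1) by (simp add: vec.span_minimal subset_antisym)
  moreover have "v \<in> topspace (frames k)"
    using v B(2) by (auto simp: frames_def v_def)
  ultimately show "V \<in> frame_span k ` topspace (frames k)"
    using v(2) by (auto simp: frame_span_def)
qed

lemma topspace_grassmannian:
  "topspace (grassmannian k) = (grassmannian_set k :: (complex ^ 'n) set set)"
proof (rule antisym)
  show "topspace (grassmannian k) \<subseteq> (grassmannian_set k :: (complex ^ 'n) set set)"
    using openin_topspace[of "grassmannian k :: (complex ^ 'n) set topology"]
    unfolding openin_grassmannian by simp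
  have "{v \<in> topspace (frames k). frame_span k v \<in> (grassmannian_set k :: (complex ^ 'n) set set)} =
    topspace (frames k)"
    using frame_span_image by blast
  then have "openin (grassmannian k) (grassmannian_set k :: (complex ^ 'n) set set)"
    by (simp add: openin_grassmannian)
  then show "(grassmannian_set k :: (complex ^ 'n) set set) \<subseteq> topspace (grassmannian k)"
    by (rule openin_subset)
qed

lemma quotient_map_grassmannian: "quotient_map (frames k) (grassmannian k) (frame_span k)"
  by (auto simp: quotient_map_def topspace_grassmannian frame_span_image openin_grassmannian)

text \<open>The total space of the tautological bundle is \<open>{(V, x). x \<in> V}\<close>.\<close>

definition tautological :: "(complex ^ 'n) set \<Rightarrow> (complex ^ 'n) set"
  where "tautological V = V"

section \<open>Symmetric powers\<close>

text \<open>
  The finite type \<open>'d\<close> indexes the tensor factors. An element of \<open>complex ^ ('d \<Rightarrow> 'n)\<close> is the array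
  of coordinates, in the standard basis, of a tensor in the \<open>'d\<close>-fold tensor power of
  \<open>complex ^ 'n\<close>. Over \<open>complex\<close>, symmetrisation identifies the quotient of the tensor power of \<open>V\<close> by
  permutations of the factors with its subspace of symmetric tensors; the latter is taken as the
  symmetric power of \<open>V\<close>.
\<close>

definition tensor_prod :: "('d::finite \<Rightarrow> complex ^ 'n) \<Rightarrow> complex ^ ('d \<Rightarrow> 'n)"
  where "tensor_prod v = (\<chi> i. \<Prod>j\<in>UNIV. v j $ i j)"

definition tensor_power :: "(complex ^ 'n) set \<Rightarrow> (complex ^ ('d::finite \<Rightarrow> 'n::finite)) set"
  where "tensor_power V = vec.span (tensor_prod ` {v. \<forall>j. v j \<in> V})"

definition symmetric_tensor :: "complex ^ ('d::finite \<Rightarrow> 'n::finite) \<Rightarrow> bool"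
  where "symmetric_tensor T \<longleftrightarrow> (\<forall>p. bij p \<longrightarrow> (\<forall>i. T $ (i \<circ> p) = T $ i))"

definition symmetric_power :: "(complex ^ 'n) set \<Rightarrow> (complex ^ ('d::finite \<Rightarrow> 'n::finite)) set"
  where "symmetric_power V = {T \<in> tensor_power V. symmetric_tensor T}"

definition symmetric_power_bundle ::
    "('b \<Rightarrow> (complex ^ 'n) set) \<Rightarrow> 'b \<Rightarrow> (complex ^ ('d::finite \<Rightarrow> 'n::finite)) set"
  where "symmetric_power_bundle E b = symmetric_power (E b)"

end

theory Submission
  imports Defs "HOL-Homology.Homology" "HOL-Combinatorics.Permutations"
begin

text \<open>
  Let \<open>N\<close> be the binomial coefficient. Multiplying polynomials of degree at most \<open>N\<close> by those of
  degree less than \<open>k\<close> gives, for every nonzero \<open>z\<close> in complex \<open>(N + 1)\<close>-space, a \<open>k\<close>-dimensional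
  subspace \<open>V z\<close> of complex \<open>n\<close>-space that only depends on the line \<open>L\<close> through \<open>z\<close>. So projective
  \<open>N\<close>-space maps to the Grassmannian, and the tautological bundle pulls back to the sum of \<open>k\<close> copies
  of \<open>L\<close>, hence its symmetric power to the sum of \<open>N\<close> copies of the \<open>d\<close>-th power of \<open>L\<close>. A section
  without zeros would yield a nowhere vanishing map \<open>f\<close> from the nonzero vectors of \<open>(N + 1)\<close>-space to
  \<open>N\<close>-space with \<open>f (u z) = u ^ d f z\<close> for \<open>\<bar>u\<bar> = 1\<close>. Its restriction to the unit sphere of \<open>N\<close>-space
  is nullhomotopic, since that sphere is contractible inside the nonzero vectors of \<open>(N + 1)\<close>-space.
  On the other hand any two such equivariant maps on that sphere are homotopic, because its space of
  circle orbits has dimension \<open>2 N - 2\<close>, less than that of the sphere; so \<open>f\<close> is homotopic to the coordinatewise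
  \<open>d\<close>-th power. The degree of the latter is nonzero: it is a composition of iterated suspensions of
  the \<open>d\<close>-th power map of the circle, which multiplies winding numbers by \<open>d\<close>.
\<close>

section \<open>The degree of power maps on spheres\<close>

text \<open>The homology of the sphere, of the sphere relative to its lower hemisphere, of the upper
  hemisphere relative to the equator, and of the equator one degree lower are linked by
  isomorphisms. These are natural for \<open>r\<close>, because fixing the last coordinate preserves
  both hemispheres and the equator. Points of all spheres are sequences, so the equator is literally
  \<open>nsphere n\<close> and one function \<open>r\<close> acts in both dimensions.\<close>

lemma Brouwer_degree2_suspension:
  assumes r: "\<And>m. m = n \<or> m = Suc n \<Longrightarrow> continuous_map (nsphere m) (nsphere m) r"
    and last: "\<And>x. r x (Suc n) = x (Suc n)"
  shows "Brouwer_degree2 (Suc n) r = Brouwer_degree2 n r"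
proof -
  let ?p = "int n"
  let ?U = "{x. (0::real) \<le> x (Suc n)}" and ?L = "{x. x (Suc n) \<le> (0::real)}"
    and ?E = "{x. x (Suc n) = (0::real)}"
  let ?S = "nsphere (Suc n)"
  let ?sub = "subtopology ?S ?U"
  let ?G = "relative_homology_group (1 + ?p) ?sub ?E"
  let ?H = "relative_homology_group (1 + ?p) ?S ?L"
  let ?R0 = "reduced_homology_group ?p (nsphere n)"
  let ?R1 = "reduced_homology_group (1 + ?p) ?S"
  let ?b = "hom_boundary (1 + ?p) ?sub ?E"
  let ?i = "hom_induced (1 + ?p) ?sub ?E ?S ?L id"
  let ?h = "hom_induced (1 + ?p) ?S {} ?S ?L id"
  let ?rG = "hom_induced (1 + ?p) ?sub ?E ?sub ?E r"
  let ?rH = "hom_induced (1 + ?p) ?S ?L ?S ?L r"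
  define D where "D = Brouwer_degree2 n r"
  have sub: "r \<in> ?U \<rightarrow> ?U" "r \<in> ?L \<rightarrow> ?L" "r \<in> ?E \<rightarrow> ?E"
    using last by auto
  have rn: "continuous_map (nsphere n) (nsphere n) r" and rS: "continuous_map ?S ?S r"
    using r by auto
  have rsub: "continuous_map ?sub ?sub r"
    using rS last by (auto simp: continuous_map_in_subtopology continuous_map_from_subtopology)
  have bi: "?b \<in> iso ?G ?R0"
    using iso_upper_hemisphere_reduced_homology_group[of ?p n] .
  have ii: "?i \<in> iso ?G ?H"
    using iso_relative_homology_group_upper_hemisphere[of "1 + ?p" "Suc n" "Suc n"] .
  have hi: "?h \<in> iso ?R1 ?H"
    using iso_reduced_homology_group_lower_hemisphere[of "Suc n" "Suc n" "1 + ?p"] by simp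
  have hom: "?b \<in> hom ?G ?R0" "?i \<in> hom ?G ?H" "?h \<in> hom ?R1 ?H"
    using bi ii hi by (auto simp: iso_def)
  have inj: "inj_on ?b (carrier ?G)" "inj_on ?h (carrier ?R1)"
    using bi hi by (auto simp: iso_def bij_betw_def)
  have eqE: "subtopology ?sub ?E = nsphere n"
    by (simp add: subtopology_subtopology subtopology_nsphere_equator flip: Collect_conj_eq
        cong: rev_conj_cong)
  have nat1: "?b (?rG y) = hom_induced ?p (nsphere n) {} (nsphere n) {} r (?b y)" for y
    using fun_cong[OF naturality_hom_induced[OF rsub sub(3), of "1 + ?p"], of y]
    by (simp add: eqE)
  have nat2: "?rH (?i y) = ?i (?rG y)" for y
    using rS rsub sub
    by (subst (1 2) hom_induced_compose') (auto simp: continuous_map_from_subtopology)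
  have nat3: "?h (hom_induced (1 + ?p) ?S {} ?S {} r x) = ?rH (?h x)" for x
    using rS sub by (subst (1 2) hom_induced_compose') auto
  \<comment> \<open>A class \<open>x\<close> is traded for a class \<open>y\<close> of the
    hemisphere pair, whose boundary lies on the equator, where \<open>r\<close> acts by the exponent
    \<open>D\<close>. Injectivity of the isomorphisms carries the exponent back to
    \<open>x\<close>.\<close>
  have "hom_induced (1 + ?p) ?S {} ?S {} r x = x [^]\<^bsub>?R1\<^esub> D" if x: "x \<in> carrier ?R1" for x
  proof -
    have "?h x \<in> carrier ?H"
      using hom(3) x by (auto simp: hom_def)
    moreover have "?i ` carrier ?G = carrier ?H"
      using ii by (simp add: iso_def bij_betw_def)
    ultimately have "?h x \<in> ?i ` carrier ?G"
      by (simp only:)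
    then obtain y where y: "y \<in> carrier ?G" "?i y = ?h x"
      by (elim imageE) (metis that)
    have yD: "y [^]\<^bsub>?G\<^esub> D \<in> carrier ?G" and xD: "x [^]\<^bsub>?R1\<^esub> D \<in> carrier ?R1"
      using x y by (auto intro: group.int_pow_closed)
    have bc: "?b y \<in> carrier ?R0"
      using hom(1) y by (auto simp: hom_def)
    have "?b (?rG y) = ?b y [^]\<^bsub>?R0\<^esub> D"
      unfolding nat1 D_def by (rule Brouwer_degree2[OF bc])
    also have "\<dots> = ?b (y [^]\<^bsub>?G\<^esub> D)"
      using hom_int_pow[OF hom(1) y(1)] by simp
    finally have "?rG y = y [^]\<^bsub>?G\<^esub> D"
      using inj(1) yD by (auto simp: inj_on_def hom_induced_carrier)
    then have "?rH (?h x) = ?h x [^]\<^bsub>?H\<^esub> D"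
      using hom_int_pow[OF hom(2) y(1)] by (simp flip: y(2) add: nat2)
    also have "\<dots> = ?h (x [^]\<^bsub>?R1\<^esub> D)"
      using hom_int_pow[OF hom(3) x] by simp
    finally have "?h (hom_induced (1 + ?p) ?S {} ?S {} r x) = ?h (x [^]\<^bsub>?R1\<^esub> D)"
      by (simp add: nat3)
    then show ?thesis
      using inj(2) xD x by (auto simp: inj_on_def hom_induced_reduced)
  qed
  then show ?thesis
    using rS Brouwer_degree2_unique[of "Suc n" r D] by (auto simp: D_def)
qed


section \<open>Winding numbers of singular chains in the circle, by continuous logarithms\<close>

definition log_increment :: "(real \<Rightarrow> complex) \<Rightarrow> complex"
  where "log_increment g = (SOME w. \<exists>L. continuous_on {0..1} L \<and>
    (\<forall>t\<in>{0..1}. g t = exp (L t)) \<and> w = L 1 - L 0)"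

text \<open>Two continuous logarithms differ by a continuous function whose distinct values are at
  least \<open>2 * pi\<close> apart, so the difference is constant on the interval. The choice in
  \<open>log_increment\<close> is therefore harmless.\<close>

lemma log_increment_eq:
  assumes L: "continuous_on {0..1} L" "\<And>t. t \<in> {0..1} \<Longrightarrow> g t = exp (L t)"
  shows "log_increment g = L 1 - L 0"
proof -
  have "L' 1 - L' 0 = L 1 - L 0"
    if L': "continuous_on {0..1} L'" "\<And>t. t \<in> {0..1} \<Longrightarrow> g t = exp (L' t)" for L'
  proof -
    define h where "h t = L t - L' t" for t
    have exph: "exp (h t) = 1" if "t \<in> {0..1}" for t
      using L(2)[OF that] L'(2)[OF that] by (simp add: h_def exp_diff)
    have "h constant_on {0..1}"
    proof (rule continuous_discrete_range_constant)
      show "continuous_on {0..1} h"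
        unfolding h_def using L(1) L'(1) by (intro continuous_intros)
      fix x :: real assume x: "x \<in> {0..1}"
      have "2 * pi \<le> norm (h y - h x)" if y: "y \<in> {0..1}" "h y \<noteq> h x" for y
      proof -
        have "exp (h y) = exp (h x)"
          using exph x y by simp
        then obtain n :: int where n: "h y = h x + (of_int (2 * n) * pi) * \<i>"
          by (metis exp_eq)
        then have "n \<noteq> 0"
          using y(2) by auto
        then have "1 \<le> \<bar>n\<bar>"
          by linarith
        then have "2 * pi * 1 \<le> 2 * pi * \<bar>real_of_int n\<bar>"
          by (intro mult_left_mono) auto
        also have "\<dots> = norm (h y - h x)"
          using n by (simp add: norm_mult)
        finally show ?thesis
          by simp
      qed
      then show "\<exists>e>0. \<forall>y. y \<in> {0..1} \<and> h y \<noteq> h x \<longrightarrow> e \<le> norm (h y - h x)"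
        by (intro exI[of _ "2 * pi"]) auto
    qed simp
    then have "h 1 = h 0"
      by (metis atLeastAtMost_iff constant_on_def order_refl zero_le_one)
    then show ?thesis
      by (simp add: h_def algebra_simps)
  qed
  then show ?thesis
    unfolding log_increment_def using L by (intro some_equality) blast+
qed

definition nsphere_to_complex :: "(nat \<Rightarrow> real) \<Rightarrow> complex"
  where "nsphere_to_complex x = Complex (x 0) (x 1)"

definition edge_point :: "real \<Rightarrow> nat \<Rightarrow> real"
  where "edge_point t = (\<lambda>i. if i = 0 then 1 - t else if i = 1 then t else 0)"

lemma edge_point_in_standard_simplex: "t \<in> {0..1} \<Longrightarrow> edge_point t \<in> standard_simplex 1"
  by (auto simp: edge_point_def standard_simplex_def)

definition simplex_increment :: "((nat \<Rightarrow> real) \<Rightarrow> nat \<Rightarrow> real) \<Rightarrow> complex"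
  where "simplex_increment f = log_increment (\<lambda>t. nsphere_to_complex (f (edge_point t)))"

text \<open>Up to the factor \<open>2 * pi * \<i>\<close> this is the winding number on cycles; since it vanishes on
  boundaries, it shows that the loops below are not null-homologous.\<close>

definition chain_increment :: "(nat \<Rightarrow> real) chain \<Rightarrow> complex"
  where "chain_increment c =
    (\<Sum>f\<in>Poly_Mapping.keys c. of_int (Poly_Mapping.lookup c f) * simplex_increment f)"

lemma chain_increment_superset:
  assumes "finite S" "Poly_Mapping.keys c \<subseteq> S"
  shows "chain_increment c = (\<Sum>f\<in>S. of_int (Poly_Mapping.lookup c f) * simplex_increment f)"
  unfolding chain_increment_def
  by (rule sum.mono_neutral_left) (use assms in \<open>auto simp: in_keys_iff\<close>)

lemma chain_increment_diff: "chain_increment (a - b) = chain_increment a - chain_increment b"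
proof -
  let ?S = "Poly_Mapping.keys a \<union> Poly_Mapping.keys b"
  have "Poly_Mapping.keys (a - b) \<subseteq> ?S"
    by (rule keys_diff)
  then show ?thesis
    using chain_increment_superset[of ?S a] chain_increment_superset[of ?S b]
      chain_increment_superset[of ?S "a - b"]
    by (simp add: lookup_minus algebra_simps sum_subtractf)
qed

lemma chain_increment_0 [simp]: "chain_increment 0 = 0"
  by (simp add: chain_increment_def)

lemma chain_increment_of [simp]: "chain_increment (frag_of f) = simplex_increment f"
  by (simp add: chain_increment_def)

lemma chain_increment_minus: "chain_increment (- a) = - chain_increment a"
  using chain_increment_diff[of 0 a] by simp

lemma chain_increment_add: "chain_increment (a + b) = chain_increment a + chain_increment b"
  using chain_increment_diff[of a "- b"] by (simp add: chain_increment_minus)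

lemma nsphere_to_complex_nonzero:
  "x \<in> topspace (nsphere 1) \<Longrightarrow> nsphere_to_complex x \<noteq> 0"
  by (auto simp: nsphere nsphere_to_complex_def complex_eq_iff)

text \<open>The triangle is contractible, so the simplex has a continuous logarithm \<open>L\<close>
  on all of it. Each face contributes a difference of values of \<open>L\<close> at two vertices,
  and the alternating sum telescopes.\<close>

lemma simplex_increment_boundary:
  assumes f: "singular_simplex 2 (nsphere 1) f"
  shows "simplex_increment (singular_face 2 0 f) - simplex_increment (singular_face 2 1 f)
    + simplex_increment (singular_face 2 2 f) = 0"
proof -
  \<comment> \<open>The standard 2-simplex, drawn as a convex set in the plane so that the logarithm
    theorem applies; \<open>pt\<close> restores the barycentric coordinates.\<close>
  define T where "T = {p :: real \<times> real. 0 \<le> fst p \<and> 0 \<le> snd p \<and> fst p + snd p \<le> 1}"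
  define pt where "pt p = (\<lambda>i::nat. if i = 0 then 1 - fst p - snd p else if i = 1 then fst p
    else if i = 2 then snd p else 0)" for p :: "real \<times> real"
  define G where "G p = nsphere_to_complex (f (pt p))" for p
  have pt: "pt p \<in> standard_simplex 2" if "p \<in> T" for p
    using that by (auto simp: standard_simplex_def T_def pt_def numeral_2_eq_2)
  have cf: "continuous_map (subtopology (powertop_real UNIV) (standard_simplex 2)) (nsphere 1) f"
    using f by (simp add: singular_simplex_def)
  have "continuous_map (top_of_set T) (powertop_real UNIV) pt"
  proof -
    have "continuous_on T (\<lambda>p. pt p k)" for k
      unfolding pt_def by (cases "k = 0"; cases "k = 1"; cases "k = 2") (auto intro!: continuous_intros)
    then show ?thesis
      by (simp add: continuous_map_componentwise_UNIV)
  qed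
  then have "continuous_map (top_of_set T) (subtopology (powertop_real UNIV) (standard_simplex 2)) pt"
    using pt by (auto simp: continuous_map_in_subtopology)
  then have fp: "continuous_map (top_of_set T) (nsphere 1) (f \<circ> pt)"
    using cf by (rule continuous_map_compose)
  have "continuous_map (top_of_set T) euclideanreal (\<lambda>p. (f \<circ> pt) p k)" for k
    using continuous_map_compose[OF fp continuous_map_nsphere_projection[of 1 k]]
    by (simp add: o_def)
  then have "continuous_on T (\<lambda>p. f (pt p) k)" for k
    by simp
  then have "continuous_on T G"
    unfolding G_def nsphere_to_complex_def Complex_eq by (intro continuous_intros) auto
  moreover have "convex T"
  proof -
    have "T = {p. 0 \<le> inner (1, 0) p} \<inter> {p. 0 \<le> inner (0, 1) p} \<inter> {p. inner (1, 1) p \<le> 1}"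
      by (auto simp: T_def)
    then show ?thesis
      by (auto intro!: convex_Int convex_halfspace_le convex_halfspace_ge)
  qed
  moreover have "G p \<noteq> 0" if "p \<in> T" for p
    unfolding G_def using continuous_map_funspace[OF fp] that
    by (intro nsphere_to_complex_nonzero) auto
  ultimately obtain L where L: "continuous_on T L" "\<And>p. p \<in> T \<Longrightarrow> G p = exp (L p)"
    by (metis continuous_logarithm_on_contractible convex_imp_contractible)
  have edge: "simplex_increment (singular_face 2 k f) = L (e 1) - L (e 0)"
    if e: "continuous_on {0..1} e" "\<And>t. t \<in> {0..1} \<Longrightarrow> e t \<in> T"
      "\<And>t. simplical_face k (edge_point t) = pt (e t)" for k e
  proof -
    have "nsphere_to_complex (singular_face 2 k f (edge_point t)) = exp (L (e t))"
      if "t \<in> {0..1}" for t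
      using that e(2,3) L(2)[of "e t"] edge_point_in_standard_simplex[of t] by (simp add: singular_face_def G_def)
    moreover have "continuous_on {0..1} (\<lambda>t. L (e t))"
      by (rule continuous_on_compose2[OF L(1) e(1)]) (use e(2) in auto)
    ultimately show ?thesis
      unfolding simplex_increment_def by (intro log_increment_eq) auto
  qed
  have "simplex_increment (singular_face 2 0 f) = L (0, 1) - L (1, 0)"
    by (subst edge[of "\<lambda>t. (1 - t, t)"])
      (auto intro!: continuous_intros simp: T_def fun_eq_iff simplical_face_def edge_point_def pt_def)
  moreover have "simplex_increment (singular_face 2 1 f) = L (0, 1) - L (0, 0)"
    by (subst edge[of "\<lambda>t. (0, t)"])
      (auto intro!: continuous_intros simp: T_def fun_eq_iff simplical_face_def edge_point_def pt_def)
  moreover have "simplex_increment (singular_face 2 2 f) = L (1, 0) - L (0, 0)"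
    by (subst edge[of "\<lambda>t. (t, 0)"])
      (auto intro!: continuous_intros simp: T_def fun_eq_iff simplical_face_def edge_point_def pt_def)
  ultimately show ?thesis
    by simp
qed

lemma chain_increment_boundary:
  assumes "singular_chain 2 (nsphere 1) d"
  shows "chain_increment (chain_boundary 2 d) = 0"
proof -
  have "Poly_Mapping.keys d \<subseteq> singular_simplex_set 2 (nsphere 1)"
    using assms by (simp add: singular_chain_def)
  then show ?thesis
  proof (induction rule: frag_induction)
    case (one f)
    then show ?case
      using simplex_increment_boundary[of f]
      by (simp add: chain_boundary_def numeral_2_eq_2 chain_increment_add chain_increment_minus chain_increment_diff)
  next
    case (diff a b)
    then show ?case
      by (simp add: chain_boundary_diff chain_increment_diff)
  qed (simp add: chain_boundary_def)
qed

section \<open>Powers in one complex coordinate of a sphere, and their degrees\<close>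

text \<open>Raises the argument to the \<open>d\<close>-th power but keeps the modulus. Applied in
  any coordinates, it preserves spheres without renormalising.\<close>

definition norm_power :: "nat \<Rightarrow> complex \<Rightarrow> complex"
  where "norm_power d z = of_real (norm z) * sgn z ^ d"

lemma norm_norm_power [simp]: "norm (norm_power d z) = norm z"
  by (simp add: norm_power_def norm_mult norm_power norm_sgn)

lemma norm_power_0 [simp]: "norm_power d 0 = 0"
  by (simp add: norm_power_def)

lemma norm_power_mult: "norm_power d (w * z) = norm_power d w * norm_power d z"
  by (simp add: norm_power_def norm_mult sgn_mult power_mult_distrib)

lemma norm_power_unit: "norm u = 1 \<Longrightarrow> norm_power d u = u ^ d"
  by (simp add: norm_power_def sgn_div_norm)

lemma continuous_on_norm_power: "continuous_on S (norm_power d)"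
proof -
  have "isCont (norm_power d) z" for z
  proof (cases "z = 0")
    case True
    \<comment> \<open>At the origin \<open>sgn\<close> is discontinuous, but preservation of the
      norm alone forces the limit 0.\<close>
    have "((\<lambda>x. norm (norm_power d x)) \<longlongrightarrow> 0) (at 0)"
      using tendsto_norm[OF tendsto_ident_at[of 0 "UNIV :: complex set"]] by simp
    then have "(norm_power d \<longlongrightarrow> 0) (at 0)"
      by (simp only: tendsto_norm_zero_iff)
    then show ?thesis
      using True by (simp add: isCont_def)
  next
    case False
    then show ?thesis
      unfolding norm_power_def[abs_def] by (intro continuous_intros) auto
  qed
  then show ?thesis
    by (simp add: continuous_at_imp_continuous_on)
qed

text \<open>Real coordinates \<open>2 * j\<close> and \<open>2 * j + 1\<close> form the complex
  coordinate \<open>j\<close>. No dimension enters, so the same function acts on every sphere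
  containing that pair, as the suspension lemma requires.\<close>

definition pair_power :: "nat \<Rightarrow> nat \<Rightarrow> (nat \<Rightarrow> real) \<Rightarrow> nat \<Rightarrow> real"
  where "pair_power d j x = (\<lambda>i.
    if i = 2 * j then Re (norm_power d (Complex (x (2 * j)) (x (2 * j + 1))))
    else if i = 2 * j + 1 then Im (norm_power d (Complex (x (2 * j)) (x (2 * j + 1))))
    else x i)"

lemma pair_power_sum_squares:
  assumes "2 * j + 1 \<le> n"
  shows "(\<Sum>i\<le>n. (pair_power d j x i)\<^sup>2) = (\<Sum>i\<le>n. (x i)\<^sup>2)"
proof -
  let ?z = "Complex (x (2 * j)) (x (2 * j + 1))"
  have eq: "{..n} = insert (2 * j) (insert (2 * j + 1) ({..n} - {2 * j, 2 * j + 1}))"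
    using assms by auto
  have "(Re (norm_power d ?z))\<^sup>2 + (Im (norm_power d ?z))\<^sup>2 = (norm ?z)\<^sup>2"
    by (simp add: cmod_power2[symmetric])
  also have "\<dots> = (x (2 * j))\<^sup>2 + (x (2 * j + 1))\<^sup>2"
    by (simp add: cmod_power2)
  finally show ?thesis
    by (subst (1 2) eq) (simp add: pair_power_def)
qed

lemma continuous_map_pair_power:
  assumes "2 * j + 1 \<le> n"
  shows "continuous_map (nsphere n) (nsphere n) (pair_power d j)"
proof -
  have proj: "continuous_map (nsphere n) euclideanreal (\<lambda>x. x k)" for k
    by (rule continuous_map_nsphere_projection)
  have "continuous_map (nsphere n) (prod_topology euclideanreal euclideanreal) (\<lambda>x. (x (2 * j), x (2 * j + 1)))"
    unfolding continuous_map_pairwise by (simp add: o_def proj)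
  then have "continuous_map (nsphere n) euclidean ((\<lambda>(a, b). Complex a b) \<circ> (\<lambda>x. (x (2 * j), x (2 * j + 1))))"
    by (rule continuous_map_compose)
      (simp add: case_prod_unfold Complex_eq prod_topology_euclidean continuous_intros)
  then have "continuous_map (nsphere n) euclidean (\<lambda>x. Complex (x (2 * j)) (x (2 * j + 1)))"
    by (simp add: o_def)
  then have "continuous_map (nsphere n) euclidean
      (norm_power d \<circ> (\<lambda>x. Complex (x (2 * j)) (x (2 * j + 1))))"
    by (rule continuous_map_compose) (simp add: continuous_on_norm_power)
  then have "continuous_map (nsphere n) euclideanreal
      (h \<circ> (norm_power d \<circ> (\<lambda>x. Complex (x (2 * j)) (x (2 * j + 1)))))"
    if "continuous_on UNIV h" for h
    by (rule continuous_map_compose) (use that in simp)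
  from this[of Re] this[of Im]
  have "continuous_map (nsphere n) euclideanreal (\<lambda>x. pair_power d j x k)" for k
    using proj[of k]
    by (cases "k = 2 * j"; cases "k = 2 * j + 1")
      (simp_all add: pair_power_def o_def continuous_intros)
  moreover have "pair_power d j \<in> topspace (nsphere n) \<rightarrow>
      {x. (\<Sum>i\<le>n. (x i)\<^sup>2) = 1 \<and> (\<forall>i>n. x i = 0)}"
    using assms by (auto simp: nsphere pair_power_sum_squares) (auto simp: pair_power_def)
  ultimately show ?thesis
    by (subst (2) nsphere) (auto simp: continuous_map_in_subtopology continuous_map_componentwise_UNIV)
qed

text \<open>The loop running \<open>d\<close> times around the circle, the barycentric coordinate
  \<open>x 1\<close> being the time. The restriction is there because singular simplices have to be
  extensional on the standard simplex.\<close>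

definition circle_loop :: "nat \<Rightarrow> (nat \<Rightarrow> real) \<Rightarrow> nat \<Rightarrow> real"
  where "circle_loop d = restrict (\<lambda>x i. if i = 0 then cos (2 * pi * d * x 1)
    else if i = 1 then sin (2 * pi * d * x 1) else 0) (standard_simplex 1)"

lemma singular_simplex_circle_loop: "singular_simplex 1 (nsphere 1) (circle_loop d)"
proof -
  let ?X = "subtopology (powertop_real UNIV) (standard_simplex 1)"
  have proj: "continuous_map ?X euclideanreal (\<lambda>x. x k)" for k
    by (intro continuous_map_from_subtopology continuous_map_product_projection) auto
  have trig: "continuous_map ?X euclideanreal (\<lambda>x. h (2 * pi * d * x 1))"
    if "continuous_on UNIV h" for h :: "real \<Rightarrow> real"
  proof -
    have "continuous_on UNIV (\<lambda>t. h (2 * pi * d * t))"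
      by (rule continuous_on_compose2[OF that]) (auto intro!: continuous_intros)
    then show ?thesis
      using continuous_map_compose[OF proj[of 1], of euclideanreal "\<lambda>t. h (2 * pi * d * t)"]
      by (simp add: o_def)
  qed
  define G :: "(nat \<Rightarrow> real) \<Rightarrow> nat \<Rightarrow> real" where "G x i = (if i = 0 then cos (2 * pi * d * x 1)
    else if i = 1 then sin (2 * pi * d * x 1) else 0)" for x i
  have "continuous_map ?X euclideanreal (\<lambda>x. G x k)" for k
    using trig[of cos] trig[of sin]
    by (cases "k = 0"; cases "k = 1") (simp_all add: G_def continuous_intros del: One_nat_def)
  moreover have "(\<Sum>i\<le>1. (G x i)\<^sup>2) = 1 \<and> (\<forall>i>1. G x i = 0)" for x
    by (simp add: G_def)
  ultimately have "continuous_map ?X (nsphere 1) G"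
    unfolding nsphere continuous_map_in_subtopology continuous_map_componentwise_UNIV by blast
  then have "continuous_map ?X (nsphere 1) (circle_loop d)"
    by (rule continuous_map_eq) (simp add: circle_loop_def G_def fun_eq_iff)
  then show ?thesis
    by (simp add: singular_simplex_def circle_loop_def)
qed

lemma simplex_increment_circle_loop: "simplex_increment (circle_loop d) = 2 * pi * d * \<i>"
proof -
  have "log_increment (\<lambda>t. nsphere_to_complex (circle_loop d (edge_point t)))
      = (2 * pi * d * of_real 1 * \<i>) - (2 * pi * d * of_real 0 * \<i>)"
  proof (rule log_increment_eq)
    fix t :: real assume "t \<in> {0..1}"
    then have "nsphere_to_complex (circle_loop d (edge_point t)) = cis (2 * pi * d * t)"
      using edge_point_in_standard_simplex[of t]
      by (simp add: nsphere_to_complex_def circle_loop_def edge_point_def cis.ctr)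
    then show "nsphere_to_complex (circle_loop d (edge_point t)) = exp (2 * pi * d * of_real t * \<i>)"
      by (simp add: cis_conv_exp mult.commute)
  qed (intro continuous_intros)
  then show ?thesis
    by (simp add: simplex_increment_def)
qed

lemma singular_relcycle_circle_loop: "singular_relcycle 1 (nsphere 1) {} (frag_of (circle_loop d))"
proof -
  \<comment> \<open>Both endpoints of the loop are the point \<open>(1, 0)\<close>, so its two faces
    cancel in the boundary.\<close>
  have "singular_face 1 0 (circle_loop d) = singular_face 1 1 (circle_loop d)"
  proof
    fix x :: "nat \<Rightarrow> real"
    show "singular_face 1 0 (circle_loop d) x = singular_face 1 1 (circle_loop d) x"
    proof (cases "x \<in> standard_simplex 0")
      case True
      then have "x 0 = 1"
        by (simp add: standard_simplex_def)
      have "singular_face 1 k (circle_loop d) x = (\<lambda>i. if i = 0 then 1 else 0)" if "k \<le> 1" for k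
      proof -
        have "simplical_face k x \<in> standard_simplex 1"
          using simplical_face_in_standard_simplex[of 1 k x] that True by simp
        moreover have "simplical_face k x 1 = (if k = 0 then 1 else 0)"
          using that \<open>x 0 = 1\<close> by (simp add: simplical_face_def)
        moreover have "cos (2 * pi * real d) = 1" "sin (2 * pi * real d) = 0"
          using cos_2npi[of d] sin_2npi[of d] by (simp_all add: mult_ac)
        ultimately show ?thesis
          using True
          by (cases "k = 0") (simp_all add: singular_face_def circle_loop_def fun_eq_iff del: One_nat_def)
      qed
      then show ?thesis
        by simp
    qed (simp add: singular_face_def)
  qed
  then have "chain_boundary 1 (frag_of (circle_loop d)) = 0"
    by (simp add: chain_boundary_def)
  then show ?thesis
    using singular_simplex_circle_loop[of d]
    by (simp add: singular_relcycle singular_chain_of)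
qed

lemma simplex_map_pair_power_circle_loop:
  "simplex_map 1 (pair_power d 0) (circle_loop 1) = circle_loop d"
proof
  fix x
  have "norm_power d (cis t) = cis (d * t)" for t :: real
    by (simp only: norm_power_unit norm_cis Complex.DeMoivre)
  then show "simplex_map 1 (pair_power d 0) (circle_loop 1) x = circle_loop d x"
    by (auto simp: simplex_map_def circle_loop_def pair_power_def fun_eq_iff simp flip: cis.ctr)
      (simp_all add: mult_ac)
qed

text \<open>If the degree vanished, the image of the simple loop, which is
  \<open>circle_loop d\<close>, would bound a 2-chain. Its increment would then be 0 instead of
  \<open>2 * pi * d * \<i>\<close>.\<close>

lemma Brouwer_degree2_pair_power_nsphere_1:
  assumes "d > 0"
  shows "Brouwer_degree2 1 (pair_power d 0) \<noteq> 0"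
proof
  let ?S = "nsphere 1"
  let ?c = "frag_of (circle_loop 1)"
  let ?x = "homologous_rel_set 1 ?S {} ?c"
  assume deg: "Brouwer_degree2 1 (pair_power d 0) = 0"
  have cm: "continuous_map ?S ?S (pair_power d 0)"
    by (rule continuous_map_pair_power) simp
  have red: "reduced_homology_group (int 1) ?S = homology_group (int 1) ?S"
    by (rule un_reduced_homology_group) simp
  have "?x \<in> carrier (reduced_homology_group (int 1) ?S)"
    unfolding red carrier_relative_homology_group using singular_relcycle_circle_loop by blast
  then have "hom_induced (int 1) ?S {} ?S {} (pair_power d 0) ?x = \<one>\<^bsub>homology_group (int 1) ?S\<^esub>"
    using Brouwer_degree2[of ?x 1 "pair_power d 0"] deg red by simp
  moreover have "hom_induced (int 1) ?S {} ?S {} (pair_power d 0) ?x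
      = homologous_rel_set 1 ?S {} (chain_map 1 (pair_power d 0) ?c)"
    using cm singular_relcycle_circle_loop by (intro hom_induced_chain_map) auto
  ultimately have "singular_relboundary 1 ?S {} (frag_of (circle_loop d))"
    unfolding one_relative_homology_group chain_map_of simplex_map_pair_power_circle_loop
    by (metis homologous_rel_set_eq_relboundary)
  then obtain b where "singular_chain 2 ?S b" "chain_boundary 2 b = frag_of (circle_loop d)"
    unfolding singular_boundary by (auto simp: numeral_2_eq_2)
  then have "simplex_increment (circle_loop d) = 0"
    using chain_increment_boundary by (metis chain_increment_of)
  then show False
    using assms by (simp add: simplex_increment_circle_loop)
qed

lemma Brouwer_degree2_pair_power_0:
  assumes "d > 0" "n \<ge> 1"
  shows "Brouwer_degree2 n (pair_power d 0) \<noteq> 0"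
  using assms(2)
proof (induction n rule: dec_induct)
  case base
  then show ?case
    using Brouwer_degree2_pair_power_nsphere_1[OF assms(1)] by simp
next
  case (step n)
  have "Brouwer_degree2 (Suc n) (pair_power d 0) = Brouwer_degree2 n (pair_power d 0)"
  proof (rule Brouwer_degree2_suspension)
    \<comment> \<open>Since \<open>n\<close> is at least 1, the suspension coordinate
      \<open>Suc n\<close> is at least 2 and so lies outside the pair 0, 1.\<close>
    show "pair_power d 0 x (Suc n) = x (Suc n)" for x
      using step by (auto simp: pair_power_def)
  qed (use step in \<open>auto intro: continuous_map_pair_power\<close>)
  then show ?case
    using step by simp
qed

definition pair_swap :: "nat \<Rightarrow> (nat \<Rightarrow> real) \<Rightarrow> nat \<Rightarrow> real"
  where "pair_swap j x = (\<lambda>i. if i = 0 then x (2 * j) else if i = 1 then x (2 * j + 1)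
    else if i = 2 * j then x 0 else if i = 2 * j + 1 then x 1 else x i)"

lemma continuous_map_pair_swap:
  assumes "2 * j + 1 \<le> n"
  shows "continuous_map (nsphere n) (nsphere n) (pair_swap j)"
proof -
  have "continuous_map (nsphere n) euclideanreal (\<lambda>x. pair_swap j x k)" for k
    unfolding pair_swap_def
    by (cases "k = 0"; cases "k = 1"; cases "k = 2 * j"; cases "k = 2 * j + 1")
      (simp_all add: continuous_map_nsphere_projection)
  moreover have "pair_swap j x \<in> {x. (\<Sum>i\<le>n. (x i)\<^sup>2) = 1 \<and> (\<forall>i>n. x i = 0)}"
    if "x \<in> topspace (nsphere n)" for x
  proof -
    define p where "p i = (if i = 0 then 2 * j else if i = 1 then 2 * j + 1
      else if i = 2 * j then 0 else if i = 2 * j + 1 then 1 else i)" for i :: nat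
    have "bij_betw p {..n} {..n}"
      by (rule bij_betwI[of _ _ _ p]) (use assms in \<open>auto simp: p_def\<close>)
    then have "(\<Sum>i\<le>n. (x (p i))\<^sup>2) = (\<Sum>i\<le>n. (x i)\<^sup>2)"
      by (rule sum.reindex_bij_betw)
    moreover have "pair_swap j x i = x (p i)" for i
      by (auto simp: pair_swap_def p_def)
    moreover have "p i = i" if "i > n" for i
      using that assms by (auto simp: p_def)
    ultimately show ?thesis
      using that by (auto simp: nsphere)
  qed
  ultimately show ?thesis
    by (subst (2) nsphere) (auto simp: continuous_map_in_subtopology continuous_map_componentwise_UNIV)
qed

text \<open>Exchanging pair \<open>j\<close> with pair 0 conjugates this map to the case
  \<open>j = 0\<close>. The exchange is an involution, so its degree squares to 1, and degrees
  multiply.\<close>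

lemma Brouwer_degree2_pair_power:
  assumes "d > 0" "2 * j + 1 \<le> n"
  shows "Brouwer_degree2 n (pair_power d j) \<noteq> 0"
proof -
  have inv: "pair_swap j \<circ> pair_swap j = id"
    by (auto simp: fun_eq_iff pair_swap_def)
  have eq: "pair_power d j = pair_swap j \<circ> (pair_power d 0 \<circ> pair_swap j)"
    by (auto simp: fun_eq_iff pair_swap_def pair_power_def)
  have cm: "continuous_map (nsphere n) (nsphere n) (pair_swap j)"
    "continuous_map (nsphere n) (nsphere n) (pair_power d 0)"
    using assms by (auto intro: continuous_map_pair_swap continuous_map_pair_power)
  have "Brouwer_degree2 n (pair_swap j) * Brouwer_degree2 n (pair_swap j) = 1"
    using Brouwer_degree2_compose[OF cm(1) cm(1)] inv by simp
  then have "Brouwer_degree2 n (pair_swap j) \<noteq> 0"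
    by auto
  moreover have "Brouwer_degree2 n (pair_power d j) =
      Brouwer_degree2 n (pair_swap j) * (Brouwer_degree2 n (pair_power d 0) * Brouwer_degree2 n (pair_swap j))"
    unfolding eq
    using Brouwer_degree2_compose[OF continuous_map_compose[OF cm] cm(1)] Brouwer_degree2_compose[OF cm]
    by simp
  moreover have "Brouwer_degree2 n (pair_power d 0) \<noteq> 0"
    using assms by (intro Brouwer_degree2_pair_power_0) auto
  ultimately show ?thesis
    by simp
qed

definition power_map :: "nat \<Rightarrow> nat \<Rightarrow> (nat \<Rightarrow> real) \<Rightarrow> nat \<Rightarrow> real"
  where "power_map d N x = (\<lambda>i. if i div 2 < N then pair_power d (i div 2) x i else x i)"

lemma Brouwer_degree2_power_map:
  assumes "d > 0" "2 * N \<le> Suc n"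
  shows "continuous_map (nsphere n) (nsphere n) (power_map d N) \<and>
    Brouwer_degree2 n (power_map d N) \<noteq> 0"
  using assms(2)
proof (induction N)
  case 0
  have "power_map d 0 = id"
    by (auto simp: power_map_def)
  then show ?case
    by (metis Brouwer_degree2_id continuous_map_id zero_neq_one)
next
  case (Suc N)
  \<comment> \<open>The pair treated by \<open>pair_power d N\<close> is still untouched by
    \<open>power_map d N\<close>, so the powers can be taken one pair after another and the degrees
    multiply.\<close>
  have eq: "power_map d (Suc N) = pair_power d N \<circ> power_map d N"
  proof (intro ext)
    fix x i
    consider "i div 2 < N" | "i = 2 * N" | "i = 2 * N + 1" | "i div 2 > N"
      by linarith
    then show "power_map d (Suc N) x i = (pair_power d N \<circ> power_map d N) x i"
      by cases (auto simp: power_map_def pair_power_def)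
  qed
  have IH: "continuous_map (nsphere n) (nsphere n) (power_map d N)"
    "Brouwer_degree2 n (power_map d N) \<noteq> 0"
    using Suc by auto
  have N: "2 * N + 1 \<le> n"
    using Suc by simp
  show ?case
    unfolding eq using continuous_map_compose[OF IH(1) continuous_map_pair_power[OF N, of d]]
      Brouwer_degree2_compose[OF IH(1) continuous_map_pair_power[OF N, of d]]
      Brouwer_degree2_pair_power[OF assms(1) N] IH(2)
    by (metis mult_eq_0_iff)
qed

section \<open>Equivariant maps between spheres\<close>

text \<open>The type fixes the ambient dimension, so spaces of lower dimension appear as coordinate
  subspaces of one \<open>complex ^ 'n\<close>.\<close>

definition coord_space :: "'n set \<Rightarrow> (complex ^ 'n::finite) set"
  where "coord_space I = {z. \<forall>i. i \<notin> I \<longrightarrow> z $ i = 0}"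

definition coord_sphere :: "'n set \<Rightarrow> (complex ^ 'n::finite) set"
  where "coord_sphere I = sphere 0 1 \<inter> coord_space I"

lemma subspace_coord_space: "subspace (coord_space I)"
  by (auto simp: coord_space_def subspace_def)

lemma coord_space_scale: "z \<in> coord_space I \<Longrightarrow> c *s z \<in> coord_space I"
  by (simp add: coord_space_def)

lemma norm_vector_scale: "norm (c *s z) = norm c * norm (z :: complex ^ 'n::finite)"
  by (simp add: norm_vec_def norm_mult L2_set_right_distrib)

lemma scaleR_eq_vector_scale: "r *\<^sub>R z = complex_of_real r *s (z :: complex ^ 'n::finite)"
  by (simp add: vec_eq_iff scaleR_conv_of_real[where ?'a = complex] del: scaleR_conv_of_real)

lemma continuous_on_vector_scale [continuous_intros]:
  fixes g :: "'a::topological_space \<Rightarrow> complex ^ 'n::finite"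
  assumes "continuous_on S c" "continuous_on S g"
  shows "continuous_on S (\<lambda>x. c x *s g x)"
  unfolding vector_scalar_mult_def using assms by (intro continuous_intros)

text \<open>Here \<open>dim\<close> is the real dimension: each index in \<open>I\<close>
  contributes the two basis vectors \<open>axis i 1\<close> and \<open>axis i \<i>\<close>.\<close>

lemma dim_coord_space: "dim (coord_space I :: (complex ^ 'n::finite) set) = 2 * card I"
proof -
  define D where "D = (\<lambda>(i, c). axis i c :: complex ^ 'n) ` (I \<times> {1, \<i>})"
  have D: "D \<subseteq> Basis"
    by (auto simp: D_def Basis_vec_def Basis_complex_def)
  have "x \<in> coord_space I \<longleftrightarrow> (\<forall>b\<in>Basis. b \<notin> D \<longrightarrow> x \<bullet> b = 0)" for x :: "complex ^ 'n"
  proof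
    assume x: "x \<in> coord_space I"
    show "\<forall>b\<in>Basis. b \<notin> D \<longrightarrow> x \<bullet> b = 0"
    proof (intro ballI impI)
      fix b :: "complex ^ 'n" assume "b \<in> Basis" "b \<notin> D"
      then obtain i c where b: "b = axis i c" "c \<in> {1, \<i>}" "i \<notin> I"
        by (auto simp: Basis_vec_def Basis_complex_def D_def)
      then show "x \<bullet> b = 0"
        using x by (simp add: inner_axis coord_space_def)
    qed
  next
    assume *: "\<forall>b\<in>Basis. b \<notin> D \<longrightarrow> x \<bullet> b = 0"
    have "x $ i = 0" if "i \<notin> I" for i
    proof -
      have "axis i c \<notin> D" if "c \<in> {1, \<i>}" for c :: complex
        using that \<open>i \<notin> I\<close> by (auto simp: D_def axis_eq_axis)
      then have "x \<bullet> axis i 1 = 0" "x \<bullet> axis i \<i> = 0"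
        using * by (auto simp: axis_in_Basis_iff Basis_complex_def)
      then show ?thesis
        by (simp add: inner_axis complex_eq_iff)
    qed
    then show "x \<in> coord_space I"
      by (simp add: coord_space_def)
  qed
  then have "coord_space I = {x :: complex ^ 'n. \<forall>b\<in>Basis. b \<notin> D \<longrightarrow> x \<bullet> b = 0}"
    by blast
  then have "dim (coord_space I :: (complex ^ 'n) set) = card D"
    using dim_substandard[OF D] by simp
  also have "\<dots> = card (I \<times> {1, \<i>})"
    unfolding D_def by (rule card_image) (auto simp: inj_on_def axis_eq_axis)
  finally show ?thesis
    by (simp add: card_cartesian_product)
qed

text \<open>The coordinate sphere is the relative frontier of a ball of real dimension
  \<open>2 * card I\<close>. Maps from closed subsets of a cell into such a frontier extend over the
  cell when its dimension is smaller than that of the ball; the cell complex is the single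
  box.\<close>

lemma extend_map_to_coord_sphere:
  fixes h :: "'a::euclidean_space \<Rightarrow> complex ^ 'n::finite"
  assumes W: "aff_dim (cbox a b) < 2 * int (card I)"
    and S: "closed S" "S \<subseteq> cbox a b"
    and h: "continuous_on S h" "h \<in> S \<rightarrow> coord_sphere I"
  obtains g where "continuous_on (cbox a b) g" "g \<in> cbox a b \<rightarrow> coord_sphere I"
    "\<And>x. x \<in> S \<Longrightarrow> g x = h x"
proof -
  let ?U = "cball 0 1 \<inter> coord_space I :: (complex ^ 'n) set"
  have sub: "subspace (coord_space I :: (complex ^ 'n) set)"
    by (rule subspace_coord_space)
  have "0 \<in> interior (cball 0 1) \<inter> (coord_space I :: (complex ^ 'n) set)"
    using subspace_0[OF sub] by simp
  then have ne: "interior (cball 0 1) \<inter> (coord_space I :: (complex ^ 'n) set) \<noteq> {}"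
    by blast
  have front: "rel_frontier ?U = coord_sphere I"
    using convex_affine_rel_frontier_Int[OF convex_cball subspace_imp_affine[OF sub] ne]
    by (simp add: coord_sphere_def)
  have "aff_dim (coord_space I \<inter> ball 0 1 :: (complex ^ 'n) set) = aff_dim (coord_space I :: (complex ^ 'n) set)"
    using ne by (intro aff_dim_convex_Int_open subspace_imp_convex sub) auto
  moreover have "aff_dim (coord_space I \<inter> ball 0 1 :: (complex ^ 'n) set) \<le> aff_dim ?U"
    by (rule aff_dim_subset) auto
  ultimately have "aff_dim ?U \<ge> 2 * int (card I)"
    by (simp add: aff_dim_subspace[OF sub] dim_coord_space)
  then have aff: "aff_dim (cbox a b) < aff_dim ?U"
    using W by simp
  show ?thesis
  proof (rule extend_map_cell_complex_to_sphere[of "{cbox a b}" S ?U h])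
    show "convex ?U" "bounded ?U"
      by (auto intro: convex_Int convex_cball subspace_imp_convex[OF sub])
  qed (use S h aff front that in \<open>auto intro: polytope_interval simp: face_of_refl\<close>)
qed

text \<open>Dividing a point of the piece below by its \<open>j\<close>-th coordinate picks one point on every circle
  orbit and lands in a box of real dimension \<open>2 * card I - 2\<close>. Together with the homotopy parameter
  this is less than \<open>2 * card I\<close>, so maps into the sphere extend over it.\<close>

definition max_piece :: "'n set \<Rightarrow> 'n \<Rightarrow> (complex ^ 'n::finite) set"
  where "max_piece I j = {z \<in> coord_sphere I. \<forall>i. norm (z $ i) \<le> norm (z $ j)}"

lemma closed_coord_space: "closed (coord_space I)"
  by (rule closed_subspace[OF subspace_coord_space])

lemma closed_coord_sphere: "closed (coord_sphere I)"
  unfolding coord_sphere_def by (intro closed_Int closed_coord_space) simp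

lemma closed_max_piece: "closed (max_piece I j)"
proof -
  have "max_piece I j = coord_sphere I \<inter> (\<Inter>i. {z. norm (z $ i) \<le> norm (z $ j)})"
    by (auto simp: max_piece_def)
  also have "closed \<dots>"
    by (intro closed_Int closed_coord_sphere closed_INT ballI closed_Collect_le continuous_intros)
  finally show ?thesis .
qed

lemma coord_sphere_scale: "z \<in> coord_sphere I \<Longrightarrow> norm u = 1 \<Longrightarrow> u *s z \<in> coord_sphere I"
  by (simp add: coord_sphere_def norm_vector_scale coord_space_scale)

lemma max_piece_scale: "z \<in> max_piece I j \<Longrightarrow> norm u = 1 \<Longrightarrow> u *s z \<in> max_piece I j"
  by (simp add: max_piece_def coord_sphere_scale norm_mult)

lemma max_piece_nonzero:
  assumes "z \<in> max_piece I j"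
  shows "z $ j \<noteq> 0" "j \<in> I"
proof -
  show "z $ j \<noteq> 0"
  proof
    assume "z $ j = 0"
    then have "z = 0"
      using assms by (simp add: max_piece_def vec_eq_iff)
    then show False
      using assms by (simp add: max_piece_def coord_sphere_def)
  qed
  then show "j \<in> I"
    using assms by (auto simp: max_piece_def coord_sphere_def coord_space_def)
qed

definition equivariant_on :: "(complex ^ 'n::finite) set \<Rightarrow> nat \<Rightarrow> (complex ^ 'n \<Rightarrow> complex ^ 'm::finite) \<Rightarrow> bool"
  where "equivariant_on S d f \<longleftrightarrow> (\<forall>z\<in>S. \<forall>u. norm u = 1 \<longrightarrow> f (u *s z) = u ^ d *s f z)"

text \<open>A stage in building the homotopy: both end maps are prescribed on the whole sphere, and
  all times are already settled over the pieces with index in \<open>J\<close>.\<close>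

definition homotopy_domain :: "'n set \<Rightarrow> 'n set \<Rightarrow> ((complex ^ 'n::finite) \<times> real) set"
  where "homotopy_domain I J = coord_sphere I \<times> {0, 1} \<union> (\<Union>j\<in>J. max_piece I j) \<times> {0..1}"

lemma closed_homotopy_domain: "closed (homotopy_domain I J)"
  unfolding homotopy_domain_def
  by (intro closed_Un closed_Times closed_UN closed_coord_sphere closed_max_piece)
    (auto intro: closed_max_piece)

lemma homotopy_domain_scale:
  "(z, t) \<in> homotopy_domain I J \<Longrightarrow> norm u = 1 \<Longrightarrow> (u *s z, t) \<in> homotopy_domain I J"
  by (auto simp: homotopy_domain_def intro: coord_sphere_scale max_piece_scale)

text \<open>Extending over one more piece needs no equivariance on a slice that meets each circle
  orbit once. The known map is extended over a box containing the slice, and rotation then spreads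
  the result over the piece.\<close>

lemma equivariant_homotopy_step:
  fixes H :: "(complex ^ 'n::finite) \<times> real \<Rightarrow> complex ^ 'n"
  assumes H: "continuous_on (homotopy_domain I J) H" "H \<in> homotopy_domain I J \<rightarrow> coord_sphere I"
    "\<And>z t u. (z, t) \<in> homotopy_domain I J \<Longrightarrow> norm u = 1 \<Longrightarrow> H (u *s z, t) = u ^ d *s H (z, t)"
    and j: "j \<in> I"
  obtains K where "continuous_on (homotopy_domain I (insert j J)) K"
    "K \<in> homotopy_domain I (insert j J) \<rightarrow> coord_sphere I"
    "\<And>z t u. (z, t) \<in> homotopy_domain I (insert j J) \<Longrightarrow> norm u = 1 \<Longrightarrow> K (u *s z, t) = u ^ d *s K (z, t)"
    "\<And>p. p \<in> homotopy_domain I J \<Longrightarrow> K p = H p"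
proof -
  let ?D = "homotopy_domain I J"
  let ?P = "max_piece I j \<times> {0..1::real}"
  \<comment> \<open>In the box between \<open>a\<close> and \<open>b\<close>, coordinate
    \<open>j\<close> is pinned to 1 and coordinates outside \<open>I\<close> to 0. The others range
    over a square containing the unit disc; the last real factor is time.\<close>
  define a :: "complex ^ 'n" where "a = (\<chi> i. if i = j then 1 else if i \<in> I then Complex (-1) (-1) else 0)"
  define b :: "complex ^ 'n" where "b = (\<chi> i. if i = j then 1 else if i \<in> I then Complex 1 1 else 0)"
  define W where "W = cbox (a, 0::real) (b, 1)"
  have W: "(w, t) \<in> W \<longleftrightarrow> (\<forall>i. Re (a $ i) \<le> Re (w $ i) \<and> Re (w $ i) \<le> Re (b $ i) \<and>
      Im (a $ i) \<le> Im (w $ i) \<and> Im (w $ i) \<le> Im (b $ i)) \<and> t \<in> {0..1}" for w t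
    by (auto simp: W_def cbox_Pair_eq mem_box Basis_vec_def Basis_complex_def inner_axis)
  have Wj: "w $ j = 1" "w \<in> coord_space I" "t \<in> {0..1}" if "(w, t) \<in> W" for w t
  proof -
    show "w $ j = 1"
      using spec[OF conjunct1[OF that[unfolded W]], of j] by (simp add: a_def b_def complex_eq_iff)
    have "w $ i = 0" if "i \<notin> I" for i
    proof -
      have "i \<noteq> j"
        using that j by blast
      then show ?thesis
        using spec[OF conjunct1[OF \<open>(w, t) \<in> W\<close>[unfolded W]], of i] that
        by (simp add: a_def b_def complex_eq_iff)
    qed
    then show "w \<in> coord_space I"
      by (simp add: coord_space_def)
    show "t \<in> {0..1}"
      using that by (simp add: W)
  qed
  have affW: "aff_dim W < 2 * int (card I)"
  proof -
    \<comment> \<open>Moving the pinned coordinate from 1 to 0 puts the box into a linear space of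
      real dimension \<open>2 * (card I - 1) + 1\<close>, the final 1 being time.\<close>
    have "aff_dim W = aff_dim ((\<lambda>x. - (axis j 1, 0) + x) ` W)"
      by (simp only: aff_dim_translation_eq)
    also have "\<dots> \<le> aff_dim ((coord_space (I - {j}) :: (complex ^ 'n) set) \<times> (UNIV :: real set))"
    proof (rule aff_dim_subset)
      show "(\<lambda>x. - (axis j 1, 0) + x) ` W \<subseteq> coord_space (I - {j}) \<times> UNIV"
        using Wj by (fastforce simp: coord_space_def axis_def)
    qed
    also have "\<dots> = int (dim ((coord_space (I - {j}) :: (complex ^ 'n) set) \<times> (UNIV :: real set)))"
      by (intro aff_dim_subspace subspace_Times subspace_coord_space) simp
    also have "\<dots> = 2 * int (card (I - {j})) + 1"
      by (subst dim_Times) (simp_all add: subspace_coord_space dim_coord_space)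
    also have "\<dots> < 2 * int (card I)"
    proof -
      have "card I = Suc (card (I - {j}))"
        using j by (intro card.remove) auto
      then show ?thesis
        by simp
    qed
    finally show ?thesis .
  qed
  \<comment> \<open>The map \<open>\<phi>\<close> sends a point of the box to the sphere by
    normalising; \<open>S\<close> below collects the points where \<open>H\<close> already
    prescribes the value.\<close>
  define \<phi> where "\<phi> = (\<lambda>(w :: complex ^ 'n, t :: real). (w /\<^sub>R norm w, t))"
  have w0: "norm w \<noteq> 0" if "(w, t) \<in> W" for w t
    using Wj(1)[OF that] by auto
  have c\<phi>: "continuous_on W \<phi>"
    unfolding \<phi>_def case_prod_unfold using w0 by (intro continuous_intros) auto
  define S where "S = W \<inter> \<phi> -` ?D"
  have "closed S"
    unfolding S_def
    by (rule continuous_closed_preimage[OF c\<phi> _ closed_homotopy_domain]) (simp add: W_def closed_cbox)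
  moreover have "continuous_on S (H \<circ> \<phi>)"
    by (rule continuous_on_compose[OF continuous_on_subset[OF c\<phi>] continuous_on_subset[OF H(1)]])
      (auto simp: S_def)
  moreover have "H \<circ> \<phi> \<in> S \<rightarrow> coord_sphere I"
    using H(2) by (auto simp: S_def)
  ultimately obtain g where g: "continuous_on W g" "g \<in> W \<rightarrow> coord_sphere I"
    "\<And>x. x \<in> S \<Longrightarrow> g x = (H \<circ> \<phi>) x"
    using extend_map_to_coord_sphere[of "(a, 0)" "(b, 1)" I S "H \<circ> \<phi>"] affW
    unfolding W_def[symmetric] by (metis Int_lower1 S_def)
  \<comment> \<open>Division by coordinate \<open>j\<close> is constant on circle orbits and lands
    in the box. The lost phase is \<open>sgn (z $ j)\<close>, and \<open>G\<close> restores it with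
    exponent \<open>d\<close>, as equivariance dictates.\<close>
  define \<psi> where "\<psi> = (\<lambda>(z :: complex ^ 'n, t :: real). ((1 / z $ j) *s z, t))"
  define G where "G p = sgn (fst p $ j) ^ d *s g (\<psi> p)" for p
  define K where "K p = (if p \<in> ?D then H p else G p)" for p
  have \<psi>W: "\<psi> p \<in> W" if "p \<in> ?P" for p
  proof -
    obtain z t where "p = (z, t)"
      by (cases p)
    then have p: "p = (z, t)" "z \<in> max_piece I j" "t \<in> {0..1}"
      using that by auto
    note zj = max_piece_nonzero[OF p(2)]
    have "norm (z $ i / z $ j) \<le> 1" for i
      using p(2) zj by (simp add: max_piece_def norm_divide)
    then have "\<bar>Re (z $ i / z $ j)\<bar> \<le> 1" "\<bar>Im (z $ i / z $ j)\<bar> \<le> 1" for i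
      using abs_Re_le_cmod abs_Im_le_cmod order_trans by blast+
    moreover have "z $ i = 0" if "i \<notin> I" for i
      using p(2) that by (simp add: max_piece_def coord_sphere_def coord_space_def)
    ultimately show ?thesis
      unfolding p(1) \<psi>_def prod.case W a_def b_def
      using p(3) zj by (auto simp: abs_le_iff minus_le_iff)
  qed
  have sgn1: "norm (sgn (z $ j)) = 1" if "z \<in> max_piece I j" for z
    using max_piece_nonzero[OF that] by (simp add: norm_sgn)
  have agree: "G p = H p" if "p \<in> ?P" "p \<in> ?D" for p
  proof -
    obtain z t where "p = (z, t)"
      by (cases p)
    then have p: "p = (z, t)" "z \<in> max_piece I j" "t \<in> {0..1}"
      using that(1) by auto
    note zj = max_piece_nonzero[OF p(2)]
    let ?u = "sgn (z $ j)"
    have u: "norm ?u = 1" "norm (inverse ?u) = 1" "?u \<noteq> 0"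
      using sgn1[OF p(2)] zj by (simp_all add: norm_inverse sgn_zero_iff)
    have nz: "norm z = 1"
      using p(2) by (simp add: max_piece_def coord_sphere_def)
    \<comment> \<open>Dividing and then normalising amounts to rotating \<open>z\<close> by the
      inverse phase, so equivariance of \<open>H\<close> yields agreement on the overlap.\<close>
    have "\<phi> (\<psi> p) = (inverse ?u *s z, t)"
      using zj nz
      by (simp add: p \<phi>_def \<psi>_def norm_vector_scale norm_divide vec_eq_iff scaleR_eq_vector_scale
          sgn_div_norm scaleR_conv_of_real[where ?'a = complex] field_simps)
    moreover have "(inverse ?u *s z, t) \<in> ?D"
      using that(2) p u homotopy_domain_scale by blast
    ultimately have "g (\<psi> p) = H (inverse ?u *s z, t)"
      using g(3)[of "\<psi> p"] \<psi>W[OF that(1)] by (simp add: S_def)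
    also have "\<dots> = inverse ?u ^ d *s H p"
      using H(3)[of z t "inverse ?u"] that(2) u p by simp
    finally show ?thesis
      using u by (simp add: G_def p(1) vector_smult_assoc flip: power_mult_distrib)
  qed
  have dom: "homotopy_domain I (insert j J) = ?D \<union> ?P"
    by (auto simp: homotopy_domain_def)
  have "continuous_on ?P \<psi>"
    unfolding \<psi>_def case_prod_unfold using max_piece_nonzero(1) by (intro continuous_intros) auto
  then have "continuous_on ?P (\<lambda>p. g (\<psi> p))"
    by (rule continuous_on_compose2[OF g(1)]) (use \<psi>W in auto)
  then have cG: "continuous_on ?P G"
    unfolding G_def using max_piece_nonzero(1) by (intro continuous_intros) auto
  have Kg: "K p = G p" if "p \<in> ?P" for p
    using agree[OF that] by (simp add: K_def)
  show ?thesis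
  proof
    show "continuous_on (homotopy_domain I (insert j J)) K"
      unfolding dom K_def
    proof (rule continuous_on_cases[OF closed_homotopy_domain _ H(1) cG])
      show "closed ?P"
        by (intro closed_Times closed_max_piece) simp
    qed (use agree in auto)
    have "K p \<in> coord_sphere I" if "p \<in> ?D" for p
      using H(2) that by (auto simp: K_def)
    moreover have "K p \<in> coord_sphere I" if "p \<in> ?P" for p
      using Kg[OF that] that g(2) \<psi>W[OF that] sgn1[of "fst p"]
      by (auto simp: G_def norm_power intro!: coord_sphere_scale)
    ultimately show "K \<in> homotopy_domain I (insert j J) \<rightarrow> coord_sphere I"
      unfolding dom by blast
    show "K (u *s z, t) = u ^ d *s K (z, t)"
      if "(z, t) \<in> homotopy_domain I (insert j J)" "norm u = 1" for z t u
    proof (cases "(z, t) \<in> ?D")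
      case True
      then show ?thesis
        using H(3)[OF True that(2)] homotopy_domain_scale[OF True that(2)] by (simp add: K_def)
    next
      case False
      then have p: "(z, t) \<in> ?P"
        using that(1) by (auto simp: dom)
      then have up: "(u *s z, t) \<in> ?P"
        using that(2) by (auto intro: max_piece_scale)
      have "u \<noteq> 0"
        using that(2) by auto
      then have "\<psi> (u *s z, t) = \<psi> (z, t)"
        by (simp add: \<psi>_def vec_eq_iff)
      moreover have "sgn (u * z $ j) = u * sgn (z $ j)"
        using that(2) by (simp add: sgn_mult) (simp add: sgn_div_norm)
      ultimately show ?thesis
        unfolding Kg[OF p] Kg[OF up] by (simp add: G_def power_mult_distrib vector_smult_assoc)
    qed
  qed (simp add: K_def)
qed

text \<open>Starting from the two end maps alone, the homotopy is extended over the pieces one index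
  at a time. Once all of \<open>I\<close> is used, the pieces cover the sphere.\<close>

lemma equivariant_homotopic:
  fixes f g :: "complex ^ 'n::finite \<Rightarrow> complex ^ 'n"
  assumes f: "continuous_on (coord_sphere I) f" "f \<in> coord_sphere I \<rightarrow> coord_sphere I"
    "equivariant_on (coord_sphere I) d f"
    and g: "continuous_on (coord_sphere I) g" "g \<in> coord_sphere I \<rightarrow> coord_sphere I"
    "equivariant_on (coord_sphere I) d g"
  shows "homotopic_with_canon (\<lambda>_. True) (coord_sphere I) (coord_sphere I) f g"
proof -
  let ?Q = "\<lambda>J H. continuous_on (homotopy_domain I J) H \<and> H \<in> homotopy_domain I J \<rightarrow> coord_sphere I \<and>
    (\<forall>z t u. (z, t) \<in> homotopy_domain I J \<longrightarrow> norm u = 1 \<longrightarrow> H (u *s z, t) = u ^ d *s H (z, t)) \<and>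
    (\<forall>z\<in>coord_sphere I. H (z, 0) = f z \<and> H (z, 1) = g z)"
  have "\<exists>H. ?Q J H" if "finite J" "J \<subseteq> I" for J
    using that
  proof (induction J)
    case empty
    define H where "H p = (if snd p = 0 then f (fst p) else g (fst p))" for p :: "(complex ^ 'n) \<times> real"
    have dom: "homotopy_domain I {} = coord_sphere I \<times> {0::real} \<union> coord_sphere I \<times> {1}"
      by (auto simp: homotopy_domain_def)
    have "continuous_on (homotopy_domain I {}) H"
      unfolding dom H_def
      by (intro continuous_on_cases closed_Times closed_coord_sphere continuous_on_compose2[OF f(1)]
          continuous_on_compose2[OF g(1)] continuous_intros) auto
    moreover have "H \<in> homotopy_domain I {} \<rightarrow> coord_sphere I"
      using f(2) g(2) by (auto simp: dom H_def)
    moreover have "H (u *s z, t) = u ^ d *s H (z, t)"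
      if "(z, t) \<in> homotopy_domain I {}" "norm u = 1" for z t u
      using f(3) g(3) that by (auto simp: dom H_def equivariant_on_def)
    moreover have "\<forall>z\<in>coord_sphere I. H (z, 0) = f z \<and> H (z, 1) = g z"
      by (simp add: H_def)
    ultimately show ?case
      by blast
  next
    case (insert j J)
    then obtain H where H: "?Q J H"
      by auto
    have "j \<in> I"
      using insert by simp
    then obtain K where K: "continuous_on (homotopy_domain I (insert j J)) K"
      "K \<in> homotopy_domain I (insert j J) \<rightarrow> coord_sphere I"
      "\<And>z t u. (z, t) \<in> homotopy_domain I (insert j J) \<Longrightarrow> norm u = 1 \<Longrightarrow> K (u *s z, t) = u ^ d *s K (z, t)"
      "\<And>p. p \<in> homotopy_domain I J \<Longrightarrow> K p = H p"
      using equivariant_homotopy_step[of I J H d j] H by metis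
    have "\<forall>z\<in>coord_sphere I. K (z, 0) = f z \<and> K (z, 1) = g z"
      using H K(4) by (auto simp: homotopy_domain_def)
    with K show ?case
      by blast
  qed
  then obtain H where H: "?Q I H"
    by (metis finite order_refl)
  have dom: "homotopy_domain I I = coord_sphere I \<times> {0..1}"
  proof -
    \<comment> \<open>A coordinate of largest modulus is nonzero on the sphere, hence its index
      belongs to \<open>I\<close>.\<close>
    have "\<exists>j\<in>I. z \<in> max_piece I j" if z: "z \<in> coord_sphere I" for z :: "complex ^ 'n"
    proof -
      obtain j where j: "norm (z $ j) = Max (range (\<lambda>i. norm (z $ i)))"
        by (metis (mono_tags, lifting) Max_in finite_imageI finite image_iff image_is_empty UNIV_not_empty)
      then have "norm (z $ i) \<le> norm (z $ j)" for i
        by simp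
      then have "z \<in> max_piece I j"
        using z by (simp add: max_piece_def)
      then show ?thesis
        using max_piece_nonzero(2) by blast
    qed
    moreover have "max_piece I j \<subseteq> coord_sphere I" for j
      by (auto simp: max_piece_def)
    ultimately show ?thesis
      by (auto simp: homotopy_domain_def)
  qed
  define K where "K p = H (snd p, fst p)" for p
  have "continuous_on ({0..1} \<times> coord_sphere I) K"
    unfolding K_def
  proof (rule continuous_on_compose2[where g = H and f = "\<lambda>p. (snd p, fst p)"])
    show "continuous_on (coord_sphere I \<times> {0..1}) H"
      using H dom by simp
  qed (auto intro!: continuous_intros)
  moreover have "K \<in> {0..1} \<times> coord_sphere I \<rightarrow> coord_sphere I"
    using H dom by (auto simp: K_def)
  ultimately have "continuous_map (prod_topology (top_of_set {0..1}) (top_of_set (coord_sphere I)))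
      (top_of_set (coord_sphere I)) K"
    by (simp add: prod_topology_subtopology_eu continuous_map_in_subtopology Pi_iff)
  moreover have "\<forall>z\<in>coord_sphere I. K (0, z) = f z \<and> K (1, z) = g z"
    using H by (simp add: K_def)
  ultimately show ?thesis
    by (subst homotopic_with) auto
qed

section \<open>The coordinatewise power as model equivariant map, and the forced zero\<close>

definition vector_power :: "nat \<Rightarrow> complex ^ 'n::finite \<Rightarrow> complex ^ 'n"
  where "vector_power d z = (\<chi> i. norm_power d (z $ i))"

lemma norm_vector_power [simp]: "norm (vector_power d z) = norm z"
  by (simp add: norm_vec_def vector_power_def)

lemma continuous_on_vector_power: "continuous_on S (vector_power d)"
  unfolding vector_power_def
  by (intro continuous_intros continuous_on_compose2[OF continuous_on_norm_power]) auto

lemma vector_power_in_coord_sphere: "z \<in> coord_sphere I \<Longrightarrow> vector_power d z \<in> coord_sphere I"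
  by (simp add: coord_sphere_def) (simp add: coord_space_def vector_power_def)

lemma equivariant_vector_power: "equivariant_on S d (vector_power d)"
  by (simp add: equivariant_on_def vector_power_def vec_eq_iff norm_power_mult norm_power_unit)

lemma sum_lessThan_double:
  "(\<Sum>m<2 * N. g m) = (\<Sum>k<N. g (2 * k) + g (2 * k + 1))" for g :: "nat \<Rightarrow> 'a::comm_monoid_add"
  by (induction N) (simp_all add: add.assoc)

lemma power2_norm_vec: "(norm z)\<^sup>2 = (\<Sum>i\<in>UNIV. (norm (z $ i))\<^sup>2)" for z :: "complex ^ 'n::finite"
  by (simp add: norm_vec_def L2_set_def sum_nonneg)

text \<open>An enumeration of \<open>I\<close> translates the map to \<open>power_map d N\<close> on
  \<open>nsphere (2 * N - 1)\<close>. Its degree is nonzero, whereas a nullhomotopic map has degree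
  0.\<close>

lemma vector_power_not_nullhomotopic:
  assumes d: "d > 0" and I: "I \<noteq> {}"
  shows "\<not> homotopic_with_canon (\<lambda>_. True) (coord_sphere I) (coord_sphere I)
    (vector_power d :: complex ^ 'n::finite \<Rightarrow> complex ^ 'n) (\<lambda>_. c)"
proof
  assume hom: "homotopic_with_canon (\<lambda>_. True) (coord_sphere I) (coord_sphere I)
    (vector_power d :: complex ^ 'n \<Rightarrow> complex ^ 'n) (\<lambda>_. c)"
  define N where "N = card I"
  define n where "n = 2 * N - 1"
  have N: "N > 0"
    using I by (simp add: N_def card_gt_0_iff)
  have atMost: "{..n} = {..<2 * N}"
    using N by (auto simp: n_def)
  obtain e where e: "bij_betw e {..<N} I"
    using ex_bij_betw_nat_finite[of I] by (auto simp: N_def atLeast0LessThan)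
  define q where "q = inv_into {..<N} e"
  have q: "q i < N" "e (q i) = i" if "i \<in> I" for i
    using e that by (auto simp: q_def bij_betw_def inv_into_into f_inv_into_f
        intro: lessThan_iff[THEN iffD1] inv_into_into)
  have qe: "q (e k) = k" "e k \<in> I" if "k < N" for k
    using e that by (auto simp: q_def bij_betw_def)
  \<comment> \<open>The maps \<open>\<phi>\<close> and \<open>\<psi>\<close> match the complex
    coordinate \<open>e k\<close> with the real coordinates \<open>2 * k\<close> and
    \<open>2 * k + 1\<close>.\<close>
  define \<phi> :: "(nat \<Rightarrow> real) \<Rightarrow> complex ^ 'n"
    where "\<phi> x = (\<chi> i. if i \<in> I then Complex (x (2 * q i)) (x (2 * q i + 1)) else 0)" for x
  define \<psi> :: "complex ^ 'n \<Rightarrow> nat \<Rightarrow> real"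
    where "\<psi> z = (\<lambda>m. if m < 2 * N then (if even m then Re else Im) (z $ e (m div 2)) else 0)" for z
  have sphere_sum: "(\<Sum>i\<in>UNIV. (norm (z $ i))\<^sup>2) = (\<Sum>k<N. (norm (z $ e k))\<^sup>2)"
    if "z \<in> coord_space I" for z :: "complex ^ 'n"
  proof -
    have "(\<Sum>i\<in>UNIV. (norm (z $ i))\<^sup>2) = (\<Sum>i\<in>I. (norm (z $ i))\<^sup>2)"
      using that by (intro sum.mono_neutral_right) (auto simp: coord_space_def)
    also have "\<dots> = (\<Sum>k<N. (norm (z $ e k))\<^sup>2)"
      by (rule sum.reindex_bij_betw[OF e, symmetric])
    finally show ?thesis .
  qed
  have \<phi>_sphere: "\<phi> x \<in> coord_sphere I" if x: "x \<in> topspace (nsphere n)" for x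
  proof -
    have sp: "\<phi> x \<in> coord_space I"
      by (simp add: coord_space_def \<phi>_def)
    have "(norm (\<phi> x))\<^sup>2 = (\<Sum>k<N. (x (2 * k))\<^sup>2 + (x (2 * k + 1))\<^sup>2)"
      unfolding power2_norm_vec sphere_sum[OF sp]
      by (intro sum.cong) (simp_all add: \<phi>_def qe cmod_power2)
    also have "\<dots> = 1"
      using x atMost sum_lessThan_double[of "\<lambda>m. (x m)\<^sup>2" N] by (simp add: nsphere)
    finally have "norm (\<phi> x) = 1"
      by (metis norm_ge_zero power2_eq_1_iff neg_0_le_iff_le not_one_le_zero)
    with sp show ?thesis
      by (simp add: coord_sphere_def)
  qed
  have "continuous_map (nsphere n) euclidean \<phi>"
  proof -
    have "continuous_on UNIV (\<lambda>x. if i \<in> I then Complex (x (2 * q i)) (x (2 * q i + 1)) else 0)" for i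
      unfolding Complex_eq
      by (cases "i \<in> I") (auto intro!: continuous_intros continuous_on_product_coordinates)
    then have "continuous_on UNIV \<phi>"
      unfolding \<phi>_def by (rule continuous_on_vec_lambda)
    then show ?thesis
      unfolding nsphere euclidean_product_topology by (auto intro: continuous_on_subset)
  qed
  then have c\<phi>: "continuous_map (nsphere n) (top_of_set (coord_sphere I)) \<phi>"
    using \<phi>_sphere by (auto simp: continuous_map_in_subtopology)
  have \<psi>_sphere: "\<psi> z \<in> {x. (\<Sum>i\<le>n. (x i)\<^sup>2) = 1 \<and> (\<forall>i>n. x i = 0)}" if z: "z \<in> coord_sphere I" for z
  proof -
    have "(\<Sum>m\<le>n. (\<psi> z m)\<^sup>2) = (\<Sum>k<N. (norm (z $ e k))\<^sup>2)"
      unfolding atMost sum_lessThan_double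
      by (intro sum.cong) (auto simp: \<psi>_def cmod_power2)
    also have "\<dots> = (norm z)\<^sup>2"
      using z by (simp only: power2_norm_vec sphere_sum coord_sphere_def Int_iff)
    also have "\<dots> = 1"
      using z by (simp add: coord_sphere_def)
    finally show ?thesis
      using N by (auto simp: \<psi>_def n_def)
  qed
  have "continuous_on (coord_sphere I) (\<lambda>z. \<psi> z m)" for m
    unfolding \<psi>_def by (cases "m < 2 * N") (auto intro!: continuous_intros)
  then have c\<psi>: "continuous_map (top_of_set (coord_sphere I)) (nsphere n) \<psi>"
    using \<psi>_sphere unfolding nsphere
    by (auto simp: continuous_map_in_subtopology continuous_map_componentwise_UNIV)
  have "homotopic_with (\<lambda>_. True) (nsphere n) (nsphere n)
      (\<psi> \<circ> (vector_power d \<circ> \<phi>)) (\<psi> \<circ> ((\<lambda>_. c) \<circ> \<phi>))"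
    by (rule homotopic_with_compose_continuous_map_left[OF
          homotopic_with_compose_continuous_map_right[OF hom c\<phi>] c\<psi>]) auto
  then have "homotopic_with (\<lambda>_. True) (nsphere n) (nsphere n)
      (\<psi> \<circ> (vector_power d \<circ> \<phi>)) (\<lambda>_. \<psi> c)"
    by (simp add: o_def)
  then have "Brouwer_degree2 n (\<psi> \<circ> (vector_power d \<circ> \<phi>)) = 0"
    by (rule Brouwer_degree2_nullhomotopic)
  moreover have "(\<psi> \<circ> (vector_power d \<circ> \<phi>)) x = power_map d N x" if "x \<in> topspace (nsphere n)" for x
  proof
    fix m
    show "(\<psi> \<circ> (vector_power d \<circ> \<phi>)) x m = power_map d N x m"
    proof (cases "m < 2 * N")
      case True
      then have "m div 2 < N"
        by simp
      moreover have "m = 2 * (m div 2) \<or> m = 2 * (m div 2) + 1"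
        by arith
      ultimately show ?thesis
        using True qe[of "m div 2"]
        by (auto simp: \<psi>_def \<phi>_def vector_power_def power_map_def pair_power_def elim!: evenE oddE)
    next
      case False
      then show ?thesis
        using that N by (auto simp: \<psi>_def power_map_def nsphere n_def)
    qed
  qed
  then have "Brouwer_degree2 n (\<psi> \<circ> (vector_power d \<circ> \<phi>)) = Brouwer_degree2 n (power_map d N)"
    by (rule Brouwer_degree2_eq)
  moreover have "Brouwer_degree2 n (power_map d N) \<noteq> 0"
    using Brouwer_degree2_power_map[OF d, of N n] by (simp add: n_def)
  ultimately show False
    by simp
qed

text \<open>Without zeros, \<open>f\<close> normalises to a map \<open>g\<close> into the sphere of
  \<open>I\<close>. Restricted to that sphere, \<open>g\<close> is homotopic to
  \<open>vector_power d\<close> by equivariance, and homotopic to a constant because the extra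
  coordinate \<open>l\<close> leaves room to contract the sphere.\<close>

lemma equivariant_map_has_zero:
  fixes f :: "complex ^ 'n::finite \<Rightarrow> complex ^ 'n"
  assumes d: "d > 0" and I: "I \<noteq> {}" "l \<notin> I"
    and f: "continuous_on (coord_space (insert l I) - {0}) f"
      "f \<in> coord_space (insert l I) - {0} \<rightarrow> coord_space I"
      "equivariant_on (coord_space (insert l I) - {0}) d f"
  shows "\<exists>z \<in> coord_space (insert l I) - {0}. f z = 0"
proof (rule ccontr)
  let ?X = "coord_space (insert l I) - {0} :: (complex ^ 'n) set"
  let ?S = "coord_sphere I :: (complex ^ 'n) set"
  assume "\<not> ?thesis"
  then have nz: "f z \<noteq> 0" if "z \<in> ?X" for z
    using that by blast
  define g where "g z = f z /\<^sub>R norm (f z)" for z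
  have cg: "continuous_on ?X g"
    unfolding g_def using f(1) nz by (intro continuous_intros) auto
  have gS: "g z \<in> ?S" if "z \<in> ?X" for z
    using f(2) nz[OF that] that subspace_scale[OF subspace_coord_space, of "f z" I "inverse (norm (f z))"]
    by (auto simp: g_def coord_sphere_def)
  have SX: "?S \<subseteq> ?X"
    by (auto simp: coord_sphere_def coord_space_def)
  have "equivariant_on ?S d g"
    unfolding equivariant_on_def
  proof (intro ballI allI impI)
    fix z :: "complex ^ 'n" and u :: complex
    assume z: "z \<in> ?S" "norm u = 1"
    then have "f (u *s z) = u ^ d *s f z"
      using f(3) SX by (auto simp: equivariant_on_def)
    then show "g (u *s z) = u ^ d *s g z"
      using z(2) by (simp add: g_def norm_vector_scale norm_power scaleR_eq_vector_scale mult.commute)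
  qed
  moreover have "continuous_on ?S g" "g \<in> ?S \<rightarrow> ?S"
    using cg continuous_on_subset SX gS by blast+
  ultimately have hom1: "homotopic_with_canon (\<lambda>_. True) ?S ?S (vector_power d) g"
    by (intro equivariant_homotopic[where d = d] continuous_on_vector_power equivariant_vector_power)
      (auto intro: vector_power_in_coord_sphere)
  \<comment> \<open>The segment from \<open>z\<close> to the unit vector in direction
    \<open>l\<close> avoids 0: its \<open>l\<close>-th coordinate is \<open>t\<close>, and at
    \<open>t = 0\<close> it is at \<open>z\<close>.\<close>
  define \<gamma> :: "real \<times> (complex ^ 'n) \<Rightarrow> complex ^ 'n"
    where "\<gamma> = (\<lambda>(t, z). (1 - t) *\<^sub>R z + t *\<^sub>R axis l 1)"
  have \<gamma>X: "\<gamma> (t, z) \<in> ?X" if "z \<in> ?S" for t z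
  proof -
    have zl: "z $ l = 0"
      using that I by (simp add: coord_sphere_def coord_space_def)
    have "\<gamma> (t, z) \<noteq> 0"
    proof
      assume 0: "\<gamma> (t, z) = 0"
      then have "\<gamma> (t, z) $ l = 0"
        by simp
      then have "t = 0"
        using zl by (simp add: \<gamma>_def)
      then show False
        using 0 that by (auto simp: \<gamma>_def coord_sphere_def)
    qed
    moreover have "\<gamma> (t, z) \<in> coord_space (insert l I)"
      using that by (simp add: \<gamma>_def coord_sphere_def coord_space_def axis_def)
    ultimately show ?thesis
      by simp
  qed
  have "continuous_on ({0..1} \<times> ?S) (\<lambda>p. g (\<gamma> p))"
  proof (rule continuous_on_compose2[OF cg])
    show "continuous_on ({0..1} \<times> ?S) \<gamma>"
      unfolding \<gamma>_def case_prod_unfold by (intro continuous_intros)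
  qed (use \<gamma>X in auto)
  then have cont: "continuous_map (prod_topology (top_of_set {0..1}) (top_of_set ?S)) (top_of_set ?S) (g \<circ> \<gamma>)"
    using \<gamma>X gS by (auto simp: prod_topology_subtopology_eu continuous_map_in_subtopology o_def)
  have "\<gamma> (0, z) = z" "\<gamma> (1, z) = axis l 1" for z
    by (simp_all add: \<gamma>_def)
  then have hom2: "homotopic_with_canon (\<lambda>_. True) ?S ?S g (\<lambda>_. g (axis l 1))"
    using cont by (subst homotopic_with) (auto intro!: exI[of _ "g \<circ> \<gamma>"])
  show False
    using vector_power_not_nullhomotopic[OF d I(1)] homotopic_with_trans[OF hom1 hom2] by blast
qed

section \<open>Tensors and multiplicities\<close>

text \<open>The exponent vector of the monomial in \<open>k\<close> variables given by the index
  tuple \<open>c\<close>. Such vectors label a basis of the symmetric power, which is where the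
  binomial coefficient arises.\<close>

definition multiplicities :: "nat \<Rightarrow> ('d::finite \<Rightarrow> nat) \<Rightarrow> nat list"
  where "multiplicities k c = map (\<lambda>i. card {j. c j = i}) [0..<k]"

lemma multiplicities_in_compositions:
  assumes "range c \<subseteq> {..<k}"
  shows "multiplicities k (c :: 'd::finite \<Rightarrow> nat) \<in> {l. length l = k \<and> sum_list l = CARD('d)}"
proof -
  have "sum_list (multiplicities k c) = (\<Sum>i<k. card {j. c j = i})"
    by (simp add: multiplicities_def interv_sum_list_conv_sum_set_nat atLeast0LessThan)
  also have "\<dots> = card (\<Union>i<k. {j. c j = i})"
    by (subst card_UN_disjoint) auto
  also have "(\<Union>i<k. {j. c j = i}) = UNIV"
    using assms by auto
  finally show ?thesis
    by (simp add: multiplicities_def)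
qed

text \<open>Equal multiplicities mean equal multisets of values, and functions with the same
  multiset of values differ by a permutation of their arguments.\<close>

lemma multiplicities_eq_permute:
  fixes c c' :: "'d::finite \<Rightarrow> nat"
  assumes "range c \<subseteq> {..<k}" "range c' \<subseteq> {..<k}" "multiplicities k c = multiplicities k c'"
  obtains p where "bij p" "c = c' \<circ> p"
proof -
  have "card {j. c j = i} = card {j. c' j = i}" for i
  proof (cases "i < k")
    case True
    then show ?thesis
      using arg_cong[OF assms(3), of "\<lambda>l. l ! i"] by (simp add: multiplicities_def)
  next
    case False
    then have "{j. c j = i} = {}" "{j. c' j = i} = {}"
      using assms(1,2) by auto
    then show ?thesis
      by simp
  qed
  then have "image_mset c (mset_set UNIV) = image_mset c' (mset_set UNIV)"
    by (intro multiset_eqI) (simp add: count_image_mset vimage_def Int_def conj_commute)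
  then obtain p where "p permutes UNIV" "\<forall>x\<in>UNIV. c x = c' (p x)"
    using image_mset_eq_implies_permutes[of UNIV c c'] by auto
  then show ?thesis
    using that[of p] by (auto simp: permutes_bij fun_eq_iff)
qed

section \<open>A projective space inside the Grassmannian\<close>

text \<open>Reading \<open>z\<close> as a polynomial of degree at most \<open>N\<close>, the vector \<open>shift e N i z\<close> is its product
  with the \<open>i\<close>-th power of the variable. Hence the \<open>k\<close> shifts are independent whenever \<open>z \<noteq> 0\<close>, and
  their span is the tensor product of the line through \<open>z\<close> with a fixed \<open>k\<close>-dimensional space.\<close>

definition shift :: "(nat \<Rightarrow> 'n) \<Rightarrow> nat \<Rightarrow> nat \<Rightarrow> complex ^ 'n::finite \<Rightarrow> complex ^ 'n"
  where "shift e N i z = (\<chi> m. let q = inv_into {..<CARD('n)} e m in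
    if i \<le> q \<and> q \<le> i + N then z $ e (q - i) else 0)"

lemma shift_scale: "shift e N i (u *s z) = u *s shift e N i z"
  by (simp add: shift_def vec_eq_iff Let_def)

lemma continuous_on_shift: "continuous_on S (shift e N i)"
proof -
  have "continuous_on S (\<lambda>z. if i \<le> q \<and> q \<le> i + N then z $ e (q - i) else 0 :: complex)" for q
    by (cases "i \<le> q \<and> q \<le> i + N") (auto intro!: continuous_intros)
  then show ?thesis
    unfolding shift_def Let_def by (intro continuous_on_vec_lambda)
qed

text \<open>The product of two nonzero polynomials is nonzero, seen on the lowest terms. The bound
  \<open>k + N\<close> leaves room for every coefficient of a product of degree at most
  \<open>N + k - 1\<close>.\<close>

lemma shift_independent:
  assumes e: "bij_betw e {..<CARD('n)} UNIV" and n: "k + N \<le> CARD('n)"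
    and z: "z \<in> coord_space (e ` {..N})" "z \<noteq> 0"
    and sum0: "(\<Sum>i<k. c i *s shift e N i (z :: complex ^ 'n::finite)) = 0" and i: "i < k"
  shows "c i = 0"
proof (rule ccontr)
  assume "c i \<noteq> 0"
  have "\<exists>j\<le>N. z $ e j \<noteq> 0"
  proof (rule ccontr)
    assume "\<not> (\<exists>j\<le>N. z $ e j \<noteq> 0)"
    then have "z $ m = 0" for m
      using z(1) by (cases "m \<in> e ` {..N}") (auto simp: coord_space_def)
    then show False
      using z(2) by (simp add: vec_eq_iff)
  qed
  define j where "j = (LEAST j. j \<le> N \<and> z $ e j \<noteq> 0)"
  have j: "j \<le> N" "z $ e j \<noteq> 0"
    using LeastI_ex[OF \<open>\<exists>j\<le>N. z $ e j \<noteq> 0\<close>] by (auto simp: j_def)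
  have jmin: "z $ e j' = 0" if "j' < j" for j'
    using not_less_Least[of j' "\<lambda>j. j \<le> N \<and> z $ e j \<noteq> 0"] that j(1) by (auto simp: j_def[symmetric])
  define i0 where "i0 = (LEAST i. i < k \<and> c i \<noteq> 0)"
  have i0: "i0 < k" "c i0 \<noteq> 0"
    using LeastI[of "\<lambda>i. i < k \<and> c i \<noteq> 0" i] \<open>c i \<noteq> 0\<close> i by (auto simp: i0_def)
  have i0min: "c i' = 0" if "i' < i0" for i'
    using not_less_Least[of i' "\<lambda>i. i < k \<and> c i \<noteq> 0"] that i0(1) by (auto simp: i0_def[symmetric])
  have "inv_into {..<CARD('n)} e (e (i0 + j)) = i0 + j"
    using e i0 j n by (intro inv_into_f_f) (auto simp: bij_betw_def)
  then have comp: "shift e N i' z $ e (i0 + j) =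
      (if i' \<le> i0 + j \<and> i0 + j \<le> i' + N then z $ e (i0 + j - i') else 0)" for i'
    by (simp add: shift_def Let_def)
  \<comment> \<open>For \<open>i' < i0\<close> the coefficient of the combination vanishes; for
    \<open>i' > i0\<close> the entry of \<open>z\<close> has index below \<open>j\<close>, or the
    shift is 0 there.\<close>
  have "c i' * shift e N i' z $ e (i0 + j) = (if i' = i0 then c i0 * z $ e j else 0)" for i'
    using i0min[of i'] jmin[of "i0 + j - i'"] j(1)
    by (cases i' i0 rule: linorder_cases) (auto simp: comp)
  then have "(\<Sum>i<k. c i *s shift e N i z) $ e (i0 + j) = c i0 * z $ e j"
    using i0 by (simp add: sum.delta)
  then show False
    using sum0 i0 j by simp
qed

lemma shift_inj_independent:
  assumes e: "bij_betw e {..<CARD('n)} UNIV" and n: "k + N \<le> CARD('n)"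
    and z: "z \<in> coord_space (e ` {..N})" "(z :: complex ^ 'n::finite) \<noteq> 0"
  shows "inj_on (\<lambda>i. shift e N i z) {..<k}" "vec.independent ((\<lambda>i. shift e N i z) ` {..<k})"
proof -
  let ?v = "\<lambda>i. shift e N i z"
  show inj: "inj_on ?v {..<k}"
  proof (rule inj_onI, rule ccontr)
    fix i i' assume i: "i \<in> {..<k}" "i' \<in> {..<k}" "?v i = ?v i'" "i \<noteq> i'"
    define c where "c m = (if m = i then 1 else if m = i' then - 1 else 0 :: complex)" for m
    have "(\<Sum>m<k. c m *s ?v m) = (\<Sum>m\<in>{i, i'}. c m *s ?v m)"
      using i by (intro sum.mono_neutral_right) (auto simp: c_def)
    also have "\<dots> = 0"
      using i by (simp add: c_def)
    finally have "c i = 0"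
      using shift_independent[OF e n z] i(1) by simp
    then show False
      by (simp add: c_def)
  qed
  show "vec.independent (?v ` {..<k})"
  proof
    assume "vec.dependent (?v ` {..<k})"
    then obtain u w where u: "w \<in> ?v ` {..<k}" "u w \<noteq> 0" "(\<Sum>w\<in>?v ` {..<k}. u w *s w) = 0"
      by (auto simp: vec.dependent_finite)
    then have "(\<Sum>i<k. u (?v i) *s ?v i) = 0"
      by (simp add: sum.reindex[OF inj])
    then show False
      using shift_independent[OF e n z, of "\<lambda>i. u (?v i)"] u(1,2) by auto
  qed
qed

definition shift_span :: "(nat \<Rightarrow> 'n) \<Rightarrow> nat \<Rightarrow> nat \<Rightarrow> complex ^ 'n::finite \<Rightarrow> (complex ^ 'n) set"
  where "shift_span e N k z = vec.span ((\<lambda>i. shift e N i z) ` {..<k})"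

lemma shift_span_scale:
  fixes z :: "complex ^ 'n::finite"
  assumes "u \<noteq> 0"
  shows "shift_span e N k (u *s z) = shift_span e N k z"
proof -
  have sub: "shift_span e N k (c *s y) \<subseteq> shift_span e N k y" for c and y :: "complex ^ 'n"
    unfolding shift_span_def
    by (rule vec.span_minimal) (auto simp: shift_scale intro!: vec.span_scale[OF vec.span_base])
  have "z = inverse u *s (u *s z)"
    using assms by (simp add: vector_smult_assoc)
  then show ?thesis
    using sub[of u z] sub[of "inverse u" "u *s z"] by auto
qed

text \<open>The map lifts to frames, where continuity is checked coordinatewise, and the quotient
  map then carries it to the Grassmannian. Frames are extensional, hence the restriction to
  \<open>{..<k}\<close>.\<close>

lemma continuous_map_shift_span:
  assumes e: "bij_betw e {..<CARD('n)} UNIV" and n: "k + N \<le> CARD('n)"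
  shows "continuous_map (top_of_set (coord_space (e ` {..N}) - {0 :: complex ^ 'n::finite}))
    (grassmannian k) (shift_span e N k)"
proof -
  let ?X = "top_of_set (coord_space (e ` {..N}) - {0 :: complex ^ 'n})"
  let ?F = "\<lambda>z. restrict (\<lambda>i. shift e N i z) {..<k}"
  have span: "frame_span k (?F z) = shift_span e N k z" for z :: "complex ^ 'n"
  proof -
    have "?F z ` {..<k} = (\<lambda>i. shift e N i z) ` {..<k}"
      by auto
    then show ?thesis
      by (simp add: frame_span_def shift_span_def)
  qed
  have "continuous_map ?X (product_topology (\<lambda>_. euclidean) {..<k}) ?F"
    by (auto simp: continuous_map_componentwise continuous_on_shift)
  moreover have "inj_on (?F z) {..<k} \<and> vec.independent (?F z ` {..<k})"
    if "z \<in> coord_space (e ` {..N}) - {0}" for z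
  proof -
    have "?F z ` {..<k} = (\<lambda>i. shift e N i z) ` {..<k}"
      by auto
    then show ?thesis
      using shift_inj_independent[OF e n, of z] that by (auto simp: inj_on_def)
  qed
  ultimately have "continuous_map ?X (frames k) ?F"
    by (auto simp: frames_def continuous_map_in_subtopology)
  then have "continuous_map ?X (grassmannian k) (frame_span k \<circ> ?F)"
    using quotient_imp_continuous_map[OF quotient_map_grassmannian] continuous_map_compose by blast
  then show ?thesis
    by (simp add: o_def span)
qed

section \<open>Detecting symmetric tensors by pairing with products of a frame\<close>

text \<open>The standard Hermitian product. Conjugation falls on the first argument, where the
  section goes, so that scaling the frame in the second yields \<open>u ^ d\<close> and not its
  conjugate.\<close>

definition tensor_pairing :: "complex ^ 'i::finite \<Rightarrow> complex ^ 'i \<Rightarrow> complex"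
  where "tensor_pairing S T = (\<Sum>i\<in>UNIV. cnj (S $ i) * T $ i)"

lemma tensor_pairing_self_eq_0: "tensor_pairing T T = 0 \<Longrightarrow> T = 0"
proof -
  assume "tensor_pairing T T = 0"
  moreover have "tensor_pairing T T = complex_of_real (\<Sum>i\<in>UNIV. (norm (T $ i))\<^sup>2)"
    by (simp only: tensor_pairing_def of_real_sum complex_norm_square mult.commute)
  ultimately have "(\<Sum>i\<in>UNIV. (norm (T $ i))\<^sup>2) = 0"
    by (metis of_real_eq_0_iff)
  then show "T = 0"
    by (simp add: sum_nonneg_eq_0_iff vec_eq_iff)
qed

lemma tensor_pairing_permute:
  fixes w :: "'d::finite \<Rightarrow> complex ^ 'n::finite"
  assumes "symmetric_tensor T" "bij p"
  shows "tensor_pairing T (tensor_prod (w \<circ> p)) = tensor_pairing T (tensor_prod w)"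
proof -
  have bij: "bij (\<lambda>i :: 'd \<Rightarrow> 'n. i \<circ> p)"
    by (rule o_bij[of "\<lambda>i. i \<circ> inv_into UNIV p"])
      (use assms(2) in \<open>auto simp: fun_eq_iff bij_is_surj surj_f_inv_f bij_is_inj inv_f_f\<close>)
  have perm: "tensor_prod (w \<circ> p) $ (i \<circ> p) = tensor_prod w $ i" for i
    using prod.reindex_bij_betw[OF assms(2), of "\<lambda>j. w j $ i j"] by (simp add: tensor_prod_def)
  have "tensor_pairing T (tensor_prod (w \<circ> p)) =
      (\<Sum>i\<in>UNIV. cnj (T $ (i \<circ> p)) * tensor_prod (w \<circ> p) $ (i \<circ> p))"
    unfolding tensor_pairing_def by (rule sum.reindex_bij_betw[OF bij, symmetric])
  also have "\<dots> = tensor_pairing T (tensor_prod w)"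
    using assms by (simp add: perm tensor_pairing_def symmetric_tensor_def)
  finally show ?thesis .
qed

text \<open>By multilinearity the products of the \<open>v i\<close> span the tensor power, so
  \<open>T\<close> is orthogonal to the whole space containing it, in particular to itself.\<close>

lemma tensor_pairing_eq_0:
  fixes v :: "nat \<Rightarrow> complex ^ 'n::finite" and T :: "complex ^ ('d::finite \<Rightarrow> 'n)"
  assumes inj: "inj_on v {..<k}" and T: "T \<in> tensor_power (vec.span (v ` {..<k}))"
    and 0: "\<And>c. range c \<subseteq> {..<k} \<Longrightarrow> tensor_pairing T (tensor_prod (\<lambda>j. v (c j))) = 0"
  shows "T = 0"
proof -
  have elem: "tensor_pairing T (tensor_prod w) = 0" if w: "\<forall>j. w j \<in> vec.span (v ` {..<k})" for w
  proof -
    have "\<exists>a. w j = (\<Sum>i<k. a i *s v i)" for j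
    proof -
      have "w j \<in> range (\<lambda>u. \<Sum>x\<in>v ` {..<k}. u x *s x)"
        using w by (simp flip: vec.span_finite)
      then show ?thesis
        by (auto simp: sum.reindex[OF inj] o_def)
    qed
    then obtain a where a: "w j = (\<Sum>i<k. a j i *s v i)" for j
      by metis
    have "tensor_prod w $ m = (\<Sum>c\<in>UNIV \<rightarrow>\<^sub>E {..<k}. (\<Prod>j\<in>UNIV. a j (c j)) *
        tensor_prod (\<lambda>j. v (c j)) $ m)" for m
    proof -
      have "tensor_prod w $ m = (\<Prod>j\<in>UNIV. \<Sum>i<k. a j i * v i $ m j)"
        by (simp add: tensor_prod_def a)
      also have "\<dots> = (\<Sum>c\<in>UNIV \<rightarrow>\<^sub>E {..<k}. \<Prod>j\<in>UNIV. a j (c j) * v (c j) $ m j)"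
        by (rule prod_sum_PiE) auto
      finally show ?thesis
        by (simp add: tensor_prod_def prod.distrib)
    qed
    then have "tensor_pairing T (tensor_prod w) =
        (\<Sum>m\<in>UNIV. \<Sum>c\<in>UNIV \<rightarrow>\<^sub>E {..<k}. (\<Prod>j\<in>UNIV. a j (c j)) *
          (cnj (T $ m) * tensor_prod (\<lambda>j. v (c j)) $ m))"
      by (simp add: tensor_pairing_def sum_distrib_left mult_ac)
    also have "\<dots> = (\<Sum>c\<in>UNIV \<rightarrow>\<^sub>E {..<k}. (\<Prod>j\<in>UNIV. a j (c j)) *
        tensor_pairing T (tensor_prod (\<lambda>j. v (c j))))"
      by (subst sum.swap) (simp add: tensor_pairing_def sum_distrib_left)
    also have "\<dots> = 0"
      using 0 by (intro sum.neutral) (auto simp: PiE_def image_subset_iff)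
    finally show ?thesis .
  qed
  have "tensor_pairing T S = 0" if "S \<in> tensor_power (vec.span (v ` {..<k}))" for S
    using that unfolding tensor_power_def
  proof (induction rule: vec.span_induct)
    show "vec.subspace {S. tensor_pairing T S = 0}"
      by (auto simp: vec.subspace_def tensor_pairing_def distrib_left sum.distrib mult.left_commute
          simp flip: sum_distrib_left)
  qed (use elem in auto)
  then show ?thesis
    using T tensor_pairing_self_eq_0 by blast
qed

lemma tensor_prod_scale:
  "tensor_prod (\<lambda>j. u *s w j) = u ^ CARD('d) *s tensor_prod w" for w :: "'d::finite \<Rightarrow> complex ^ 'n::finite"
  by (simp add: tensor_prod_def vec_eq_iff prod.distrib)

lemma tensor_pairing_scale: "tensor_pairing S (c *s T) = c * tensor_pairing S T"
  by (simp add: tensor_pairing_def sum_distrib_left mult.left_commute)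

theorem theorem6:
  fixes s :: "(complex ^ 'n::finite) set \<Rightarrow> (complex ^ 'n) set \<times> (complex ^ ('d::finite \<Rightarrow> 'n))"
    and d k n :: nat
  assumes "CARD('d) = d" and "CARD('n) = n"
    and "d > 0" and "k > 0"
    and "n \<ge> k + ((d + k - 1) choose d)"
    and "bundle_section (grassmannian k) (symmetric_power_bundle tautological) s"
  shows "\<exists>V \<in> topspace (grassmannian k). s V = (V, 0)"
proof -
  define N where "N = (d + k - 1) choose d"
  define A where "A = {l :: nat list. length l = k \<and> sum_list l = d}"
  have N0: "N > 0"
    using assms(3,4) by (simp add: N_def)
  have cardA: "card A = N"
    using card_length_sum_list[of k d] by (simp add: A_def N_def)
  then have "finite A"
    using N0 card_gt_0_iff[of A] by simp
  then obtain b where b: "bij_betw b A {..<N}"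
    using ex_bij_betw_finite_nat[of A] cardA by (auto simp: atLeast0LessThan)
  obtain e :: "nat \<Rightarrow> 'n" where e: "bij_betw e {..<CARD('n)} UNIV"
    using ex_bij_betw_nat_finite[of "UNIV :: 'n set"] by (auto simp: atLeast0LessThan)
  have n: "k + N \<le> CARD('n)"
    using assms(2,5) by (simp add: N_def)
  define I where "I = e ` {..<N}"
  \<comment> \<open>The index \<open>N\<close> is included: \<open>k > 0\<close> makes
    \<open>N\<close> smaller than the dimension, so one direction \<open>e N\<close> remains outside
    \<open>I\<close>.\<close>
  have inj: "inj_on e {..N}"
    using e n assms(4) by (auto simp: bij_betw_def intro: inj_on_subset)
  have I: "I \<noteq> {}" "e N \<notin> I" "insert (e N) I = e ` {..N}"
  proof -
    show "I \<noteq> {}"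
      using N0 by (auto simp: I_def)
    show "e N \<notin> I"
      by (auto simp: I_def dest!: inj_onD[OF inj])
    show "insert (e N) I = e ` {..N}"
      by (simp add: I_def lessThan_Suc flip: lessThan_Suc_atMost)
  qed
  let ?X = "coord_space (e ` {..N}) - {0 :: complex ^ 'n}"
  let ?V = "shift_span e N k"
  \<comment> \<open>One index tuple is chosen for each of the \<open>N\<close> exponent vectors,
    numbered by \<open>b\<close>.\<close>
  define rep :: "nat \<Rightarrow> 'd \<Rightarrow> nat"
    where "rep q = (SOME c. range c \<subseteq> {..<k} \<and> multiplicities k c = inv_into A b q)" for q
  define \<sigma> where "\<sigma> z = snd (s (?V z))" for z
  \<comment> \<open>The \<open>N\<close> coordinates in \<open>I\<close> record the pairings of the
    section with one product of frame vectors per exponent vector.\<close>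
  define f :: "complex ^ 'n \<Rightarrow> complex ^ 'n" where "f z = (\<chi> m. if m \<in> I then
      tensor_pairing (\<sigma> z) (tensor_prod (\<lambda>j. shift e N (rep (inv_into {..<N} e m) j) z)) else 0)" for z
  have V: "continuous_map (top_of_set ?X) (grassmannian k) ?V"
    by (rule continuous_map_shift_span[OF e n])
  have s: "continuous_map (grassmannian k) (total_space (grassmannian k) (symmetric_power_bundle tautological)) s"
    "\<And>W. W \<in> topspace (grassmannian k) \<Longrightarrow> fst (s W) = W"
    using assms(6) by (auto simp: bundle_section_def)
  have Vtop: "?V z \<in> topspace (grassmannian k)" if "z \<in> ?X" for z
    using continuous_map_funspace[OF V] that by auto
  have \<sigma>_sym: "\<sigma> z \<in> symmetric_power (?V z)" if "z \<in> ?X" for z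
  proof -
    have "s (?V z) \<in> Sigma (topspace (grassmannian k)) (symmetric_power_bundle tautological)"
      using continuous_map_funspace[OF s(1)] Vtop[OF that] by (auto simp: total_space_def)
    then show ?thesis
      using s(2)[OF Vtop[OF that]]
      by (auto simp: \<sigma>_def symmetric_power_bundle_def tautological_def split: prod.splits)
  qed
  have c\<sigma>: "continuous_on ?X \<sigma>"
  proof -
    have "continuous_map (grassmannian k) (prod_topology (grassmannian k) euclidean) s"
      using s(1) by (simp add: total_space_def continuous_map_in_subtopology)
    then have "continuous_map (grassmannian k) euclidean (snd \<circ> s)"
      by (simp add: continuous_map_pairwise)
    then have "continuous_map (top_of_set ?X) euclidean ((snd \<circ> s) \<circ> ?V)"
      using V continuous_map_compose by blast
    then show ?thesis
      by (simp add: \<sigma>_def o_def)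
  qed
  have "continuous_on ?X (\<lambda>z. tensor_pairing (\<sigma> z) (tensor_prod (\<lambda>j. shift e N (c j) z)))" for c :: "'d \<Rightarrow> nat"
    unfolding tensor_pairing_def tensor_prod_def
    by (simp, intro continuous_intros c\<sigma> continuous_on_shift)
  then have "continuous_on ?X (\<lambda>z. f z $ m)" for m
    by (cases "m \<in> I") (simp_all add: f_def)
  then have "continuous_on ?X (\<lambda>z. \<chi> m. f z $ m)"
    by (rule continuous_on_vec_lambda)
  then have "continuous_on ?X f"
    by simp
  moreover have "f \<in> ?X \<rightarrow> coord_space I"
    by (simp add: f_def coord_space_def)
  moreover have "equivariant_on ?X d f"
    unfolding equivariant_on_def
  proof (intro ballI allI impI)
    fix z :: "complex ^ 'n" and u :: complex
    assume "norm u = 1"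
    then have "u \<noteq> 0"
      by auto
    \<comment> \<open>Scaling leaves the subspace and hence the value of the section unchanged, so
      only the product of the \<open>d\<close> shifts contributes a factor.\<close>
    then have "\<sigma> (u *s z) = \<sigma> z"
      by (simp add: \<sigma>_def shift_span_scale)
    then have "f (u *s z) $ m = (u ^ d *s f z) $ m" for m
      by (simp add: f_def shift_scale tensor_prod_scale tensor_pairing_scale assms(1))
    then show "f (u *s z) = u ^ d *s f z"
      by (simp add: vec_eq_iff)
  qed
  ultimately obtain z where z: "z \<in> ?X" "f z = 0"
    using equivariant_map_has_zero[OF assms(3) I(1,2), of f] unfolding I(3) by blast
  \<comment> \<open>Any index tuple is a permutation of the chosen one with the same exponents, and
    pairing with a symmetric tensor ignores the permutation. So the vanishing of \<open>f z\<close>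
    kills all pairings.\<close>
  have "tensor_pairing (\<sigma> z) (tensor_prod (\<lambda>j. shift e N (c j) z)) = 0"
    if c: "range c \<subseteq> {..<k}" for c :: "'d \<Rightarrow> nat"
  proof -
    define q where "q = b (multiplicities k c)"
    have cA: "multiplicities k c \<in> A"
      using multiplicities_in_compositions[OF c] assms(1) by (simp add: A_def)
    then have q: "q < N" "inv_into A b q = multiplicities k c"
      using b by (auto simp: q_def bij_betw_def)
    then have rep: "range (rep q) \<subseteq> {..<k} \<and> multiplicities k (rep q) = multiplicities k c"
      unfolding rep_def using someI[of "\<lambda>c'. range c' \<subseteq> {..<k} \<and> multiplicities k c' = inv_into A b q" c] c
      by simp
    then obtain p where p: "bij p" "c = rep q \<circ> p"
      using multiplicities_eq_permute[of c k "rep q"] c by metis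
    have "inv_into {..<N} e (e q) = q"
      using inj q(1) by (intro inv_into_f_f) (auto intro: inj_on_subset)
    moreover have "f z $ e q = 0" "e q \<in> I"
      using z(2) q(1) by (auto simp: I_def)
    ultimately have "tensor_pairing (\<sigma> z) (tensor_prod (\<lambda>j. shift e N (rep q j) z)) = 0"
      by (simp add: f_def)
    then show ?thesis
      using tensor_pairing_permute[OF _ p(1), of "\<sigma> z" "\<lambda>j. shift e N (rep q j) z"] \<sigma>_sym[OF z(1)]
      by (simp add: p(2) o_def symmetric_power_def)
  qed
  moreover have "\<sigma> z \<in> tensor_power (?V z)"
    using \<sigma>_sym[OF z(1)] by (simp add: symmetric_power_def)
  ultimately have "\<sigma> z = 0"
    using shift_inj_independent(1)[OF e n, of z] z(1)
    by (intro tensor_pairing_eq_0[of "\<lambda>i. shift e N i z" k]) (auto simp: shift_span_def)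
  then have "s (?V z) = (?V z, 0)"
    using s(2)[OF Vtop[OF z(1)]] by (simp add: \<sigma>_def prod_eq_iff)
  then show ?thesis
    using Vtop[OF z(1)] by blast
qed

end
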